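(* Let $U$ and $V$ be two vector spaces over $\mathbb{K}$ in duality via a bilinear form $\langle\cdot,\cdot\rangle$. Then the joint tensor algebra $\mathcal{T}(U,V)=\mathcal{T}(U)\otimes\mathcal{T}(V)$ equipped with the square product $\square$ is a unital associative algebra.
   Context: $\mathbb{K}$ is $\mathbb{R}$ or $\mathbb{C}$. $\mathcal{T}(U)=\bigoplus_{n\ge 0}\bigotimes^n U$ (with $\bigotimes^0U=\mathbb{K}$) is the tensor algebra with concatenation product. It is a Hopf algebra whose co-multiplication $\Delta$ is the algebra homomorphism determined by $\Delta(\mathbf{1})=\mathbf{1}\otimes\mathbf{1}$, $\Delta(x)=\mathbf{1}\otimes x+x\otimes\mathbf{1}$ for $x\in U$; the same applies to $\mathcal{T}(V)$. The joint tensor algebra $\mathcal{T}(U,V)=\mathcal{T}(U)\otimes\mathcal{T}(V)$ is the tensor product of these Hopf algebras: its product is $(u_1\otimes v_1)\cdot(u_2\otimes v_2)=(u_1\cdot u_2)\otimes(v_1\cdot v_2)$, its unit is $\mathbf{1}=1\otimes 1$, and its co-multiplication is $u\otimes v\mapsto\sum_{(u),(v)}(u_{(1)}\otimes v_{(1)})\otimes(u_{(2)}\otimes v_{(2)})$. Sweedler notation $\sum_{(a)}a_{(1)}\otimes a_{(2)}$ is used for the co-multiplication of $a$. A Laplace pairing on $\mathcal{T}(U,V)$ is a symmetric bilinear form $(\cdot|\cdot)$ with values in $\mathbb{K}$ satisfying $(a|bc)=\sum_{(a)}(a_{(1)}|b)(a_{(2)}|c)$ for all $a,b,c\in\mathcal{T}(U,V)$.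 It is compatible with the duality if: (i) $(\mathbf{1}|\mathbf{1})=1$; (ii) $(1\otimes y|x\otimes 1)=(x\otimes 1|1\otimes y)=\langle x,y\rangle$; (iii) $(x_1\otimes 1|x_2\otimes 1)=(1\otimes y_1|1\otimes y_2)=0$; (iv) $(x\otimes 1|1\otimes 1)=(1\otimes 1|x\otimes 1)=(1\otimes 1|1\otimes y)=(1\otimes y|1\otimes 1)=0$, for all $x,x_1,x_2\in U$ and $y,y_1,y_2\in V$. There is exactly one Laplace pairing compatible with the duality, and $(\cdot|\cdot)$ denotes it. The square product of $a,b\in\mathcal{T}(U,V)$ is $a\,\square\, b=\sum_{(a),(b)}(a_{(1)}|b_{(1)})\,a_{(2)}\cdot b_{(2)}$, where $\cdot$ is the ordinary product of $\mathcal{T}(U,V)$. *)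

theory Defs
  imports Complex_Main "HOL-Library.Poly_Mapping" "HOL-Algebra.Module"
begin

text \<open>Scalars form a type \<open>'k\<close>.  In the class \<open>real_normed_field\<close> (field extensions of the reals
  with a multiplicative norm) the only fields, up to isomorphism, are the reals and the
  complex numbers.  The ground field is a module over itself, which also serves as the ring
  of scalars; vector spaces are the modules over it.\<close>

definition ground_field :: "('k::field, 'k) module" where
  "ground_field = \<lparr>carrier = UNIV, mult = (*), one = 1, zero = 0, add = (+), smult = (*)\<rparr>"

definition bilinear_form ::
  "('k::field, 'm) module \<Rightarrow> ('k, 'n) module \<Rightarrow> ('m \<Rightarrow> 'n \<Rightarrow> 'k) \<Rightarrow> bool" where
  "bilinear_form M N f \<longleftrightarrow>
    (\<forall>x\<in>carrier M. \<forall>x'\<in>carrier M. \<forall>y\<in>carrier N. f (x \<oplus>\<^bsub>M\<^esub> x') y = f x y + f x' y) \<and>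
    (\<forall>x\<in>carrier M. \<forall>y\<in>carrier N. \<forall>y'\<in>carrier N. f x (y \<oplus>\<^bsub>N\<^esub> y') = f x y + f x y') \<and>
    (\<forall>c. \<forall>x\<in>carrier M. \<forall>y\<in>carrier N. f (c \<odot>\<^bsub>M\<^esub> x) y = c * f x y) \<and>
    (\<forall>c. \<forall>x\<in>carrier M. \<forall>y\<in>carrier N. f x (c \<odot>\<^bsub>N\<^esub> y) = c * f x y)"

text \<open>The library's locale \<open>algebra\<close> requires a commutative product; this is its
  non-commutative counterpart.  Here \<open>ring\<close> supplies associativity and the unit.\<close>

locale unital_associative_algebra = module R A + ring A for R (structure) and A (structure) +
  assumes smult_mult_left:
      "\<lbrakk>c \<in> carrier R; x \<in> carrier A; y \<in> carrier A\<rbrakk> \<Longrightarrow>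
        (c \<odot>\<^bsub>A\<^esub> x) \<otimes>\<^bsub>A\<^esub> y = c \<odot>\<^bsub>A\<^esub> (x \<otimes>\<^bsub>A\<^esub> y)"
    and smult_mult_right:
      "\<lbrakk>c \<in> carrier R; x \<in> carrier A; y \<in> carrier A\<rbrakk> \<Longrightarrow>
        x \<otimes>\<^bsub>A\<^esub> (c \<odot>\<^bsub>A\<^esub> y) = c \<odot>\<^bsub>A\<^esub> (x \<otimes>\<^bsub>A\<^esub> y)"


section \<open>Quotients of free vector spaces\<close>

text \<open>Formal linear combinations of generators are finitely supported functions
  \<open>'g \<Rightarrow>\<^sub>0 'k\<close>; quotient vectors are cosets of the span of a set \<open>R\<close> of relators.\<close>

abbreviation scale_comb :: "'k::field \<Rightarrow> ('g \<Rightarrow>\<^sub>0 'k) \<Rightarrow> ('g \<Rightarrow>\<^sub>0 'k)" where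
  "scale_comb c \<equiv> Poly_Mapping.map ((*) c)"

definition coset :: "('g \<Rightarrow>\<^sub>0 'k::field) set \<Rightarrow> ('g \<Rightarrow>\<^sub>0 'k) \<Rightarrow> ('g \<Rightarrow>\<^sub>0 'k) set" where
  "coset R p = {q. q - p \<in> Modules.module.span scale_comb R}"

text \<open>The bilinear extension of a binary operation on generators to formal combinations.\<close>

definition comb_mult ::
  "('g \<Rightarrow> 'g \<Rightarrow> 'g) \<Rightarrow> ('g \<Rightarrow>\<^sub>0 'k::field) \<Rightarrow> ('g \<Rightarrow>\<^sub>0 'k) \<Rightarrow> ('g \<Rightarrow>\<^sub>0 'k)" where
  "comb_mult m p q =
    (\<Sum>g\<in>Poly_Mapping.keys p. \<Sum>h\<in>Poly_Mapping.keys q.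
      Poly_Mapping.single (m g h) (Poly_Mapping.lookup p g * Poly_Mapping.lookup q h))"

text \<open>The vector space with generators \<open>S\<close> and relators \<open>R\<close>, whose product and unit are
  induced by \<open>m\<close> and \<open>e\<close> on generators.  Operations on cosets are given through
  representatives; the unions are unions of equal cosets whenever the operation is
  compatible with \<open>R\<close>.\<close>

definition presented_algebra ::
  "'g set \<Rightarrow> ('g \<Rightarrow>\<^sub>0 'k::field) set \<Rightarrow> ('g \<Rightarrow> 'g \<Rightarrow> 'g) \<Rightarrow> 'g \<Rightarrow> ('k, ('g \<Rightarrow>\<^sub>0 'k) set) module"
  where
  "presented_algebra S R m e =
    \<lparr>carrier = coset R ` {p. Poly_Mapping.keys p \<subseteq> S},
     mult = (\<lambda>X Y. \<Union>p\<in>X. \<Union>q\<in>Y. coset R (comb_mult m p q)),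
     one = coset R (Poly_Mapping.single e 1),
     zero = coset R 0,
     add = (\<lambda>X Y. \<Union>p\<in>X. \<Union>q\<in>Y. coset R (p + q)),
     smult = (\<lambda>c X. \<Union>p\<in>X. coset R (scale_comb c p))\<rparr>"

text \<open>The linear map on a quotient determined by its values \<open>f\<close> on generators (for \<open>f\<close>
  respecting the relators, so that all representatives \<open>p \<in> X\<close> give the same vector).\<close>

definition lin_ext :: "('k::field, 'm) module \<Rightarrow> ('g \<Rightarrow> 'm) \<Rightarrow> ('g \<Rightarrow>\<^sub>0 'k) set \<Rightarrow> 'm" where
  "lin_ext M f X =
    the_elem ((\<lambda>p. \<Oplus>\<^bsub>M\<^esub>g\<in>Poly_Mapping.keys p. Poly_Mapping.lookup p g \<odot>\<^bsub>M\<^esub> f g) ` X)"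


section \<open>Tensor products of algebras\<close>

definition bilinear_relators ::
  "('k::field, 'a) module \<Rightarrow> ('k, 'b) module \<Rightarrow> ('a \<times> 'b \<Rightarrow>\<^sub>0 'k) set" where
  "bilinear_relators A B =
    {Poly_Mapping.single (a \<oplus>\<^bsub>A\<^esub> a', b) 1 - Poly_Mapping.single (a, b) 1
        - Poly_Mapping.single (a', b) 1
      | a a' b. a \<in> carrier A \<and> a' \<in> carrier A \<and> b \<in> carrier B} \<union>
    {Poly_Mapping.single (a, b \<oplus>\<^bsub>B\<^esub> b') 1 - Poly_Mapping.single (a, b) 1
        - Poly_Mapping.single (a, b') 1
      | a b b'. a \<in> carrier A \<and> b \<in> carrier B \<and> b' \<in> carrier B} \<union>
    {Poly_Mapping.single (c \<odot>\<^bsub>A\<^esub> a, b) 1 - Poly_Mapping.single (a, b) c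
      | c a b. a \<in> carrier A \<and> b \<in> carrier B} \<union>
    {Poly_Mapping.single (a, c \<odot>\<^bsub>B\<^esub> b) 1 - Poly_Mapping.single (a, b) c
      | c a b. a \<in> carrier A \<and> b \<in> carrier B}"

definition tensor_product ::
  "('k::field, 'a) module \<Rightarrow> ('k, 'b) module \<Rightarrow> ('k, ('a \<times> 'b \<Rightarrow>\<^sub>0 'k) set) module" where
  "tensor_product A B =
    presented_algebra (carrier A \<times> carrier B) (bilinear_relators A B)
      (\<lambda>(a, b) (a', b'). (a \<otimes>\<^bsub>A\<^esub> a', b \<otimes>\<^bsub>B\<^esub> b')) (\<one>\<^bsub>A\<^esub>, \<one>\<^bsub>B\<^esub>)"

definition pure_tensor ::
  "('k::field, 'a) module \<Rightarrow> ('k, 'b) module \<Rightarrow> 'a \<Rightarrow> 'b \<Rightarrow> ('a \<times> 'b \<Rightarrow>\<^sub>0 'k) set" where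
  "pure_tensor A B a b = coset (bilinear_relators A B) (Poly_Mapping.single (a, b) 1)"

text \<open>For \<open>D = \<Sum>\<^sub>i a\<^sub>i \<otimes> b\<^sub>i\<close> this is \<open>\<Sum>\<^sub>i f a\<^sub>i b\<^sub>i\<close>: with \<open>D\<close> the co-multiplication of an
  element, it is the Sweedler sum of \<open>f\<close>.\<close>

definition sweedler ::
  "('k::field, 'm) module \<Rightarrow> ('a \<Rightarrow> 'b \<Rightarrow> 'm) \<Rightarrow> ('a \<times> 'b \<Rightarrow>\<^sub>0 'k) set \<Rightarrow> 'm" where
  "sweedler M f D = lin_ext M (\<lambda>(a, b). f a b) D"


section \<open>The tensor algebra and its co-multiplication\<close>

text \<open>A word \<open>[x\<^sub>1, \<dots>, x\<^sub>n]\<close> stands for \<open>x\<^sub>1 \<otimes> \<dots> \<otimes> x\<^sub>n\<close>.  The relators are homogeneous in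
  the length of words, so the quotient is the direct sum over \<open>n\<close> of the \<open>n\<close>-fold tensor
  powers; there are no relators of length \<open>0\<close>, so the part of degree \<open>0\<close> is the ground field.\<close>

definition multilinear_relators :: "('k::field, 'u) module \<Rightarrow> ('u list \<Rightarrow>\<^sub>0 'k) set" where
  "multilinear_relators U =
    {Poly_Mapping.single (v @ [x \<oplus>\<^bsub>U\<^esub> y] @ w) 1 - Poly_Mapping.single (v @ [x] @ w) 1
        - Poly_Mapping.single (v @ [y] @ w) 1
      | v w x y. v \<in> lists (carrier U) \<and> w \<in> lists (carrier U) \<and>
          x \<in> carrier U \<and> y \<in> carrier U} \<union>
    {Poly_Mapping.single (v @ [c \<odot>\<^bsub>U\<^esub> x] @ w) 1 - Poly_Mapping.single (v @ [x] @ w) c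
      | v w c x. v \<in> lists (carrier U) \<and> w \<in> lists (carrier U) \<and> x \<in> carrier U}"

definition tensor_algebra ::
  "('k::field, 'u) module \<Rightarrow> ('k, ('u list \<Rightarrow>\<^sub>0 'k) set) module" where
  "tensor_algebra U = presented_algebra (lists (carrier U)) (multilinear_relators U) (@) []"

definition tensor_inj :: "('k::field, 'u) module \<Rightarrow> 'u \<Rightarrow> ('u list \<Rightarrow>\<^sub>0 'k) set" where
  "tensor_inj U x = coset (multilinear_relators U) (Poly_Mapping.single [x] 1)"

text \<open>The algebra homomorphism with \<open>x \<mapsto> \<one> \<otimes> x + x \<otimes> \<one>\<close> for \<open>x\<close> in \<open>U\<close>: a word is sent to
  the product of the values of its letters.\<close>

definition tensor_coproduct ::
  "('k::field, 'u) module \<Rightarrow> ('u list \<Rightarrow>\<^sub>0 'k) set \<Rightarrow>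
    (('u list \<Rightarrow>\<^sub>0 'k) set \<times> ('u list \<Rightarrow>\<^sub>0 'k) set \<Rightarrow>\<^sub>0 'k) set" where
  "tensor_coproduct U =
    (let T = tensor_algebra U; TT = tensor_product T T in
      lin_ext TT
        (\<lambda>w. foldr
          (\<lambda>x z. (pure_tensor T T \<one>\<^bsub>T\<^esub> (tensor_inj U x) \<oplus>\<^bsub>TT\<^esub>
                   pure_tensor T T (tensor_inj U x) \<one>\<^bsub>T\<^esub>) \<otimes>\<^bsub>TT\<^esub> z)
          w \<one>\<^bsub>TT\<^esub>))"


section \<open>The joint tensor algebra, Laplace pairings and the square product\<close>

type_synonym ('k, 'u, 'v) joint =
  "(('u list \<Rightarrow>\<^sub>0 'k) set \<times> ('v list \<Rightarrow>\<^sub>0 'k) set \<Rightarrow>\<^sub>0 'k) set"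

definition joint_algebra ::
  "('k::field, 'u) module \<Rightarrow> ('k, 'v) module \<Rightarrow> ('k, ('k, 'u, 'v) joint) module" where
  "joint_algebra U V = tensor_product (tensor_algebra U) (tensor_algebra V)"

abbreviation joint_tensor ::
  "('k::field, 'u) module \<Rightarrow> ('k, 'v) module \<Rightarrow>
    ('u list \<Rightarrow>\<^sub>0 'k) set \<Rightarrow> ('v list \<Rightarrow>\<^sub>0 'k) set \<Rightarrow> ('k, 'u, 'v) joint" where
  "joint_tensor U V \<equiv> pure_tensor (tensor_algebra U) (tensor_algebra V)"

definition joint_coproduct ::
  "('k::field, 'u) module \<Rightarrow> ('k, 'v) module \<Rightarrow> ('k, 'u, 'v) joint \<Rightarrow>
    (('k, 'u, 'v) joint \<times> ('k, 'u, 'v) joint \<Rightarrow>\<^sub>0 'k) set" where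
  "joint_coproduct U V =
    (let J = joint_algebra U V; JJ = tensor_product J J in
      lin_ext JJ
        (\<lambda>(u, v).
          sweedler JJ
            (\<lambda>u1 u2. sweedler JJ
              (\<lambda>v1 v2. pure_tensor J J (joint_tensor U V u1 v1) (joint_tensor U V u2 v2))
              (tensor_coproduct V v))
            (tensor_coproduct U u)))"

definition laplace_pairing ::
  "('k::field, 'u) module \<Rightarrow> ('k, 'v) module \<Rightarrow>
    (('k, 'u, 'v) joint \<Rightarrow> ('k, 'u, 'v) joint \<Rightarrow> 'k) \<Rightarrow> bool" where
  "laplace_pairing U V L \<longleftrightarrow>
    (let J = joint_algebra U V in
      bilinear_form J J L \<and>
      (\<forall>a\<in>carrier J. \<forall>b\<in>carrier J. L a b = L b a) \<and>
      (\<forall>a\<in>carrier J. \<forall>b\<in>carrier J. \<forall>c\<in>carrier J.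
        L a (b \<otimes>\<^bsub>J\<^esub> c) =
          sweedler ground_field (\<lambda>a1 a2. L a1 b * L a2 c) (joint_coproduct U V a)))"

text \<open>Below \<open>I\<close> is the unit \<open>1 \<otimes> 1\<close>, \<open>i x\<close> is \<open>x \<otimes> 1\<close> and \<open>j y\<close> is \<open>1 \<otimes> y\<close>.\<close>

definition compatible_with_duality ::
  "('k::field, 'u) module \<Rightarrow> ('k, 'v) module \<Rightarrow> ('u \<Rightarrow> 'v \<Rightarrow> 'k) \<Rightarrow>
    (('k, 'u, 'v) joint \<Rightarrow> ('k, 'u, 'v) joint \<Rightarrow> 'k) \<Rightarrow> bool" where
  "compatible_with_duality U V d L \<longleftrightarrow>
    (let I = \<one>\<^bsub>joint_algebra U V\<^esub>;
         i = (\<lambda>x. joint_tensor U V (tensor_inj U x) \<one>\<^bsub>tensor_algebra V\<^esub>);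
         j = (\<lambda>y. joint_tensor U V \<one>\<^bsub>tensor_algebra U\<^esub> (tensor_inj V y)) in
      L I I = 1 \<and>
      (\<forall>x\<in>carrier U. \<forall>y\<in>carrier V. L (j y) (i x) = d x y \<and> L (i x) (j y) = d x y) \<and>
      (\<forall>x1\<in>carrier U. \<forall>x2\<in>carrier U. L (i x1) (i x2) = 0) \<and>
      (\<forall>y1\<in>carrier V. \<forall>y2\<in>carrier V. L (j y1) (j y2) = 0) \<and>
      (\<forall>x\<in>carrier U. L (i x) I = 0 \<and> L I (i x) = 0) \<and>
      (\<forall>y\<in>carrier V. L I (j y) = 0 \<and> L (j y) I = 0))"

definition square_product ::
  "('k::field, 'u) module \<Rightarrow> ('k, 'v) module \<Rightarrow>
    (('k, 'u, 'v) joint \<Rightarrow> ('k, 'u, 'v) joint \<Rightarrow> 'k) \<Rightarrow>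
    ('k, 'u, 'v) joint \<Rightarrow> ('k, 'u, 'v) joint \<Rightarrow> ('k, 'u, 'v) joint" where
  "square_product U V L a b =
    (let J = joint_algebra U V in
      sweedler J
        (\<lambda>a1 a2. sweedler J
          (\<lambda>b1 b2. L a1 b1 \<odot>\<^bsub>J\<^esub> (a2 \<otimes>\<^bsub>J\<^esub> b2))
          (joint_coproduct U V b))
        (joint_coproduct U V a))"

end

theory Submission
  imports Defs
begin

text \<open>Write \<open>J\<close> for the joint tensor algebra and \<open>\<Delta>\<close> for its co-multiplication.  Associativity of the
  square product is a computation with three properties of \<open>\<Delta>\<close>: it is multiplicative,
  coassociative and cocommutative.  Multiplicativity of \<open>\<Delta>\<close> and the Laplace identity
  \<open>(a b | c) = \<Sum> (a | c\<^sub>1) (b | c\<^sub>2)\<close> turn \<open>(a \<box> b) \<box> c\<close> into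
  \<open>\<Sum> (a\<^sub>1 | b\<^sub>1) (a\<^sub>2 | c\<^sub>1) (b\<^sub>2 | c\<^sub>2) a\<^sub>3 b\<^sub>3 c\<^sub>3\<close>, while its mirror image turns \<open>a \<box> (b \<box> c)\<close> into
  \<open>\<Sum> (b\<^sub>1 | c\<^sub>1) (a\<^sub>1 | b\<^sub>2) (a\<^sub>2 | c\<^sub>2) a\<^sub>3 b\<^sub>3 c\<^sub>3\<close>.  The two differ by exchanging \<open>b\<^sub>1\<close> with \<open>b\<^sub>2\<close> and
  \<open>c\<^sub>1\<close> with \<open>c\<^sub>2\<close>, which cocommutativity allows.  For the unit, the Laplace identity makes
  \<open>(1 | \<cdot>)\<close> multiplicative, and compatibility with the duality makes it vanish on the generators,
  so \<open>(1 | \<cdot>)\<close> is the counit.\<close>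

text \<open>All maps involved are linear and \<open>J\<close> is spanned by the elements \<open>e(u, v) = u \<otimes> v\<close> for words \<open>u\<close>
  and \<open>v\<close>, so that it suffices to compute on those.  There the co-multiplication is the sum over
  all ways to split \<open>u\<close> and \<open>v\<close> into two complementary subwords, and its three properties become
  identities between iterated sums with values in an arbitrary commutative monoid
  (\<open>pair_split_sum_append\<close>, \<open>pair_split_sum_coassoc\<close>, \<open>pair_split_sum_cocomm\<close>), proved by induction
  on words.  Products \<open>e(p) \<box> e(q)\<close> are the images under a linear map \<open>joint_comb\<close> of elements
  \<open>word_square p q\<close> of the free vector space on pairs of words, and associativity is checked there,
  in \<open>word_square_assoc\<close>, before any relation is imposed.\<close>

text \<open>The rest is linear algebra with presented spaces.  A map given on generators descends to the
  quotient when it kills the relators; for tensor products and tensor algebras this means being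
  bilinear and multilinear.  The lemmas \<open>sweedler_lin_map\<close>, \<open>sweedler_pure\<close> and
  \<open>nested_sweedler_bilin\<close> show that Sweedler sums of multilinear expressions are well defined and
  multilinear, and \<open>sweedler_joint_coproduct\<close> evaluates them on words.\<close>

section \<open>Formal linear combinations\<close>

lemma lookup_scale_comb [simp]:
  "Poly_Mapping.lookup (scale_comb c p) g = c * Poly_Mapping.lookup p g"
  by (simp add: Poly_Mapping.map.rep_eq when_def)

lemma keys_scale_comb: "Poly_Mapping.keys (scale_comb c p) \<subseteq> Poly_Mapping.keys p"
  by (auto simp: in_keys_iff)

lemma scale_comb_single [simp]:
  "scale_comb c (Poly_Mapping.single g b) = Poly_Mapping.single g (c * b)"
  by (rule poly_mapping_eqI) (simp add: lookup_single when_def)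

lemma scale_comb_add: "scale_comb c (p + q) = scale_comb c p + scale_comb c q"
  by (rule poly_mapping_eqI) (simp add: lookup_add algebra_simps)

lemma scale_comb_zero [simp]: "scale_comb c 0 = 0"
  by (rule poly_mapping_eqI) simp

lemma module_scale_comb:
  "Modules.module (scale_comb :: 'k::field \<Rightarrow> ('g \<Rightarrow>\<^sub>0 'k) \<Rightarrow> _)"
proof (rule Modules.module.intro)
  fix a b :: 'k and x y :: "'g \<Rightarrow>\<^sub>0 'k"
  show "scale_comb a (x + y) = scale_comb a x + scale_comb a y" by (rule scale_comb_add)
  show "scale_comb (a + b) x = scale_comb a x + scale_comb b x"
    by (rule poly_mapping_eqI) (simp add: lookup_add distrib_right)
  show "scale_comb a (scale_comb b x) = scale_comb (a * b) x"
    by (rule poly_mapping_eqI) (simp add: mult.assoc)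
  show "scale_comb 1 x = x"
    by (rule poly_mapping_eqI) simp
qed

abbreviation comb_span :: "('g \<Rightarrow>\<^sub>0 'k::field) set \<Rightarrow> ('g \<Rightarrow>\<^sub>0 'k) set" where
  "comb_span \<equiv> Modules.module.span scale_comb"

lemmas comb_span_base = Modules.module.span_base[OF module_scale_comb]
  and comb_span_zero = Modules.module.span_zero[OF module_scale_comb]
  and comb_span_add = Modules.module.span_add[OF module_scale_comb]
  and comb_span_diff = Modules.module.span_diff[OF module_scale_comb]
  and comb_span_scale = Modules.module.span_scale[OF module_scale_comb]
  and comb_span_induct = Modules.module.span_induct_alt[OF module_scale_comb, consumes 1]

lemma sum_single_lookup:
  "(\<Sum>g\<in>Poly_Mapping.keys p. Poly_Mapping.single g (Poly_Mapping.lookup p g)) = p"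
  by (rule poly_mapping_eqI)
    (auto simp: lookup_sum lookup_single when_def in_keys_iff)

text \<open>Additive properties of formal combinations only have to be checked on multiples of
  generators. The support is tracked because maps given on generators are meaningful only on
  \<open>S\<close>.\<close>

lemma poly_mapping_additive_induct [consumes 1, case_names zero single add]:
  fixes p :: "'g \<Rightarrow>\<^sub>0 'k::comm_monoid_add"
  assumes "Poly_Mapping.keys p \<subseteq> S"
    and "P 0"
    and "\<And>g c. g \<in> S \<Longrightarrow> P (Poly_Mapping.single g c)"
    and "\<And>p q. Poly_Mapping.keys p \<subseteq> S \<Longrightarrow> Poly_Mapping.keys q \<subseteq> S \<Longrightarrow> P p \<Longrightarrow> P q \<Longrightarrow> P (p + q)"
  shows "P p"
proof -
  have "P (\<Sum>g\<in>K. Poly_Mapping.single g (Poly_Mapping.lookup p g)) \<and>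
      Poly_Mapping.keys (\<Sum>g\<in>K. Poly_Mapping.single g (Poly_Mapping.lookup p g)) \<subseteq> S"
    if "finite K" "K \<subseteq> S" for K
    using that
  proof (induction K rule: finite_induct)
    case empty
    then show ?case using assms(2) by simp
  next
    case (insert g K)
    let ?s = "Poly_Mapping.single g (Poly_Mapping.lookup p g)"
    have "Poly_Mapping.keys ?s \<subseteq> S" using insert.prems by (auto split: if_splits)
    then show ?case
      using insert assms(3)[of g "Poly_Mapping.lookup p g"] assms(4)[of ?s]
      by (auto dest!: subsetD[OF Poly_Mapping.keys_add])
  qed
  from this[OF finite_keys assms(1)] show ?thesis
    by (simp add: sum_single_lookup)
qed

lemma sum_keys_superset:
  assumes "finite K" "Poly_Mapping.keys p \<subseteq> K" and "\<And>g. F g 0 = 0"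
  shows "(\<Sum>g\<in>Poly_Mapping.keys p. F g (Poly_Mapping.lookup p g)) =
    (\<Sum>g\<in>K. F g (Poly_Mapping.lookup p g))"
  using assms by (intro sum.mono_neutral_left) (auto simp: in_keys_iff)

text \<open>A sum over the support is additive in the combination although the support itself is not:
  vanishing of \<open>F g 0\<close> allows all three sums to range over the union of the supports.\<close>

lemma sum_keys_add:
  fixes F :: "'g \<Rightarrow> 'k::comm_monoid_add \<Rightarrow> 'm::comm_monoid_add"
  assumes F0: "\<And>g. F g 0 = 0" and "\<And>g a b. F g (a + b) = F g a + F g b"
  shows "(\<Sum>g\<in>Poly_Mapping.keys (p + q). F g (Poly_Mapping.lookup (p + q) g)) =
    (\<Sum>g\<in>Poly_Mapping.keys p. F g (Poly_Mapping.lookup p g)) +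
    (\<Sum>g\<in>Poly_Mapping.keys q. F g (Poly_Mapping.lookup q g))"
proof -
  let ?K = "Poly_Mapping.keys p \<union> Poly_Mapping.keys q"
  have K: "finite ?K" by simp
  show ?thesis
    unfolding sum_keys_superset[where p = "p + q", OF K Poly_Mapping.keys_add, of F, OF F0]
      sum_keys_superset[where p = p, OF K Un_upper1, of F, OF F0]
      sum_keys_superset[where p = q, OF K Un_upper2, of F, OF F0]
    by (simp add: assms(2) lookup_add sum.distrib)
qed

lemma comb_mult_add_left: "comb_mult m (p + p') q = comb_mult m p q + comb_mult m p' q"
  unfolding comb_mult_def
  by (rule sum_keys_add[where F = "\<lambda>g a. \<Sum>h\<in>Poly_Mapping.keys q.
        Poly_Mapping.single (m g h) (a * Poly_Mapping.lookup q h)"])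
    (simp_all add: algebra_simps single_add sum.distrib)

lemma comb_mult_add_right: "comb_mult m p (q + q') = comb_mult m p q + comb_mult m p q'"
proof -
  have "(\<Sum>h\<in>Poly_Mapping.keys (q + q').
        Poly_Mapping.single (m g h) (a * Poly_Mapping.lookup (q + q') h)) =
      (\<Sum>h\<in>Poly_Mapping.keys q. Poly_Mapping.single (m g h) (a * Poly_Mapping.lookup q h)) +
      (\<Sum>h\<in>Poly_Mapping.keys q'. Poly_Mapping.single (m g h) (a * Poly_Mapping.lookup q' h))" for g a
    by (rule sum_keys_add[where F = "\<lambda>h b. Poly_Mapping.single (m g h) (a * b)"])
      (simp_all add: algebra_simps single_add)
  then show ?thesis
    by (simp add: comb_mult_def sum.distrib)
qed

lemma comb_mult_single:
  "comb_mult m (Poly_Mapping.single g a) (Poly_Mapping.single h b) =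
    Poly_Mapping.single (m g h) (a * b)"
  by (simp add: comb_mult_def)

lemma comb_mult_zero [simp]: "comb_mult m 0 q = 0" "comb_mult m p 0 = 0"
  by (simp_all add: comb_mult_def)

lemma comb_mult_minus_left: "comb_mult m (p - p') q = comb_mult m p q - comb_mult m p' q"
  using comb_mult_add_left[of m "p - p'" p' q] by (simp add: algebra_simps)

lemma comb_mult_minus_right: "comb_mult m p (q - q') = comb_mult m p q - comb_mult m p q'"
  using comb_mult_add_right[of m p "q - q'" q'] by (simp add: algebra_simps)

lemma comb_mult_scale_left: "comb_mult m (scale_comb c p) q = scale_comb c (comb_mult m p q)"
  using subset_UNIV[of "Poly_Mapping.keys p"]
proof (induction p rule: poly_mapping_additive_induct)
  case (single g b)
  show ?case
    using subset_UNIV[of "Poly_Mapping.keys q"]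
  proof (induction q rule: poly_mapping_additive_induct)
    case (add p q)
    then show ?case by (simp add: comb_mult_add_right scale_comb_add)
  qed (simp_all add: comb_mult_single mult.assoc mult.left_commute)
qed (simp_all add: comb_mult_add_left scale_comb_add)

lemma comb_mult_scale_right: "comb_mult m p (scale_comb c q) = scale_comb c (comb_mult m p q)"
  using subset_UNIV[of "Poly_Mapping.keys q"]
proof (induction q rule: poly_mapping_additive_induct)
  case (single g b)
  show ?case
    using subset_UNIV[of "Poly_Mapping.keys p"]
  proof (induction p rule: poly_mapping_additive_induct)
    case (add p q)
    then show ?case by (simp add: comb_mult_add_left scale_comb_add)
  qed (simp_all add: comb_mult_single mult.assoc mult.left_commute)
qed (simp_all add: comb_mult_add_right scale_comb_add)

lemma keys_comb_mult:
  assumes "Poly_Mapping.keys p \<subseteq> S" "Poly_Mapping.keys q \<subseteq> S"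
    and "\<And>g h. g \<in> S \<Longrightarrow> h \<in> S \<Longrightarrow> m g h \<in> S"
  shows "Poly_Mapping.keys (comb_mult m p q) \<subseteq> S"
proof -
  have "m g h \<in> S" if "g \<in> Poly_Mapping.keys p" "h \<in> Poly_Mapping.keys q" for g h
    using assms that by blast
  then show ?thesis
    unfolding comb_mult_def by (auto dest!: subsetD[OF Poly_Mapping.keys_sum] split: if_splits)
qed

section \<open>Linear maps between modules over the ground field\<close>

lemma ground_field_simps [simp]:
  "carrier ground_field = UNIV" "a \<otimes>\<^bsub>ground_field\<^esub> b = a * b" "\<one>\<^bsub>ground_field\<^esub> = 1"
  "\<zero>\<^bsub>ground_field\<^esub> = 0" "a \<oplus>\<^bsub>ground_field\<^esub> b = a + b" "a \<odot>\<^bsub>ground_field\<^esub> b = a * b"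
  by (simp_all add: ground_field_def)

lemma cring_ground_field: "cring (ground_field :: ('k::field, 'k) module)"
proof (intro cringI abelian_groupI comm_monoidI)
  show "\<exists>y\<in>carrier ground_field. y \<oplus>\<^bsub>ground_field\<^esub> x = \<zero>\<^bsub>ground_field\<^esub>" for x :: 'k
    by (auto intro: exI[of _ "- x"])
qed (auto simp: algebra_simps)

lemma module_ground_field: "module ground_field (ground_field :: ('k::field, 'k) module)"
proof (rule module.intro)
  show "cring (ground_field :: ('k::field, 'k) module)" by (rule cring_ground_field)
  then show "abelian_group (ground_field :: ('k::field, 'k) module)"
    by (simp add: cring_def ring_def)
qed (unfold_locales, auto simp: algebra_simps)

text \<open>Additivity and homogeneity are required on the carrier only, as the modules are given by
  explicit carriers inside a type.\<close>

definition lin_map :: "('k::field, 'm) module \<Rightarrow> ('k, 'n) module \<Rightarrow> ('m \<Rightarrow> 'n) \<Rightarrow> bool" where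
  "lin_map M N \<phi> \<longleftrightarrow>
    (\<forall>x\<in>carrier M. \<phi> x \<in> carrier N) \<and>
    (\<forall>x\<in>carrier M. \<forall>y\<in>carrier M. \<phi> (x \<oplus>\<^bsub>M\<^esub> y) = \<phi> x \<oplus>\<^bsub>N\<^esub> \<phi> y) \<and>
    (\<forall>c. \<forall>x\<in>carrier M. \<phi> (c \<odot>\<^bsub>M\<^esub> x) = c \<odot>\<^bsub>N\<^esub> \<phi> x)"

definition bilin_map ::
  "('k::field, 'a) module \<Rightarrow> ('k, 'b) module \<Rightarrow> ('k, 'm) module \<Rightarrow> ('a \<Rightarrow> 'b \<Rightarrow> 'm) \<Rightarrow> bool" where
  "bilin_map A B M f \<longleftrightarrow>
    (\<forall>a\<in>carrier A. lin_map B M (f a)) \<and> (\<forall>b\<in>carrier B. lin_map A M (\<lambda>a. f a b))"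

lemma lin_mapI:
  assumes "\<And>x. x \<in> carrier M \<Longrightarrow> \<phi> x \<in> carrier N"
    and "\<And>x y. x \<in> carrier M \<Longrightarrow> y \<in> carrier M \<Longrightarrow> \<phi> (x \<oplus>\<^bsub>M\<^esub> y) = \<phi> x \<oplus>\<^bsub>N\<^esub> \<phi> y"
    and "\<And>c x. x \<in> carrier M \<Longrightarrow> \<phi> (c \<odot>\<^bsub>M\<^esub> x) = c \<odot>\<^bsub>N\<^esub> \<phi> x"
  shows "lin_map M N \<phi>"
  using assms by (simp add: lin_map_def)

lemma lin_mapD:
  assumes "lin_map M N \<phi>"
  shows "x \<in> carrier M \<Longrightarrow> \<phi> x \<in> carrier N"
    and "x \<in> carrier M \<Longrightarrow> y \<in> carrier M \<Longrightarrow> \<phi> (x \<oplus>\<^bsub>M\<^esub> y) = \<phi> x \<oplus>\<^bsub>N\<^esub> \<phi> y"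
    and "x \<in> carrier M \<Longrightarrow> \<phi> (c \<odot>\<^bsub>M\<^esub> x) = c \<odot>\<^bsub>N\<^esub> \<phi> x"
  using assms by (simp_all add: lin_map_def)

lemma bilin_mapI:
  assumes "\<And>a. a \<in> carrier A \<Longrightarrow> lin_map B M (f a)"
    and "\<And>b. b \<in> carrier B \<Longrightarrow> lin_map A M (\<lambda>a. f a b)"
  shows "bilin_map A B M f"
  using assms by (simp add: bilin_map_def)

lemma bilin_mapD:
  assumes "bilin_map A B M f"
  shows "a \<in> carrier A \<Longrightarrow> lin_map B M (f a)"
    and "b \<in> carrier B \<Longrightarrow> lin_map A M (\<lambda>a. f a b)"
    and "a \<in> carrier A \<Longrightarrow> b \<in> carrier B \<Longrightarrow> f a b \<in> carrier M"
  using assms by (auto simp: bilin_map_def lin_map_def)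

lemma lin_map_comp:
  assumes "lin_map M N \<phi>" "lin_map N Q \<psi>"
  shows "lin_map M Q (\<lambda>x. \<psi> (\<phi> x))"
  using assms by (simp add: lin_map_def)

lemma lin_map_cong:
  assumes "\<And>x. x \<in> carrier M \<Longrightarrow> \<phi> x = \<psi> x" "lin_map M N \<psi>" "module ground_field M"
  shows "lin_map M N \<phi>"
proof -
  interpret module ground_field M by fact
  have "c \<odot>\<^bsub>M\<^esub> x \<in> carrier M" if "x \<in> carrier M" for c x using that by simp
  then show ?thesis using assms(1,2) by (simp add: lin_map_def)
qed

lemma lin_map_add:
  assumes "lin_map P M \<phi>" "lin_map P M \<psi>" "module ground_field M"
  shows "lin_map P M (\<lambda>x. \<phi> x \<oplus>\<^bsub>M\<^esub> \<psi> x)"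
proof -
  interpret M: module ground_field M by fact
  show ?thesis
    by (rule lin_mapI) (simp_all add: lin_mapD[OF assms(1)] lin_mapD[OF assms(2)]
        M.a_ac M.smult_r_distr)
qed

lemma lin_map_smult:
  assumes "lin_map P M \<phi>" "module ground_field M"
  shows "lin_map P M (\<lambda>x. c \<odot>\<^bsub>M\<^esub> \<phi> x)"
proof -
  interpret M: module ground_field M by fact
  show ?thesis
  proof (rule lin_mapI)
    show "c \<odot>\<^bsub>M\<^esub> \<phi> (b \<odot>\<^bsub>P\<^esub> x) = b \<odot>\<^bsub>M\<^esub> (c \<odot>\<^bsub>M\<^esub> \<phi> x)" if "x \<in> carrier P" for b x
      using M.smult_assoc1[of c b "\<phi> x"] M.smult_assoc1[of b c "\<phi> x"] that
      by (simp add: lin_mapD[OF assms(1)] mult.commute)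
  qed (simp_all add: lin_mapD[OF assms(1)] M.smult_r_distr)
qed

lemma lin_map_smult_left:
  assumes "lin_map P ground_field \<phi>" "module ground_field M" "m \<in> carrier M"
  shows "lin_map P M (\<lambda>x. \<phi> x \<odot>\<^bsub>M\<^esub> m)"
proof -
  interpret M: module ground_field M by fact
  show ?thesis using assms(3)
    by (intro lin_mapI) (simp_all add: lin_mapD[OF assms(1)] M.smult_l_distr[simplified]
        M.smult_assoc1[simplified])
qed

text \<open>The zero vector is the multiple by \<open>0\<close> of itself, so homogeneity suffices.\<close>

lemma lin_map_zero:
  assumes "lin_map M N \<phi>" "module ground_field M" "module ground_field N"
  shows "\<phi> \<zero>\<^bsub>M\<^esub> = \<zero>\<^bsub>N\<^esub>"
proof -
  interpret M: module ground_field M by fact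
  interpret N: module ground_field N by fact
  have "\<phi> \<zero>\<^bsub>M\<^esub> = \<phi> (0 \<odot>\<^bsub>M\<^esub> \<zero>\<^bsub>M\<^esub>)" by (simp add: M.smult_r_null)
  also have "\<dots> = 0 \<odot>\<^bsub>N\<^esub> \<phi> \<zero>\<^bsub>M\<^esub>" by (rule lin_mapD[OF assms(1)]) simp
  also have "\<dots> = \<zero>\<^bsub>N\<^esub>" using N.smult_l_null lin_mapD(1)[OF assms(1)] by simp
  finally show ?thesis .
qed

section \<open>Evaluating formal combinations in a module\<close>

text \<open>The linear extension of \<open>f\<close> to formal combinations, the map from which \<open>lin_ext\<close> is
  obtained by passing to cosets.\<close>

definition eval_comb :: "('k::field, 'm) module \<Rightarrow> ('g \<Rightarrow> 'm) \<Rightarrow> ('g \<Rightarrow>\<^sub>0 'k) \<Rightarrow> 'm" where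
  "eval_comb M f p =
    (\<Oplus>\<^bsub>M\<^esub>g\<in>Poly_Mapping.keys p. Poly_Mapping.lookup p g \<odot>\<^bsub>M\<^esub> f g)"

locale evaluation = module ground_field M for M :: "('k::field, 'm) module" +
  fixes S :: "'g set" and f :: "'g \<Rightarrow> 'm"
  assumes f_closed: "g \<in> S \<Longrightarrow> f g \<in> carrier M"
begin

lemma smult_f_closed: "g \<in> S \<Longrightarrow> c \<odot>\<^bsub>M\<^esub> f g \<in> carrier M"
  using f_closed smult_closed by simp

lemma eval_closed: "Poly_Mapping.keys p \<subseteq> S \<Longrightarrow> eval_comb M f p \<in> carrier M"
  unfolding eval_comb_def by (intro finsum_closed) (auto intro: smult_f_closed)

lemma eval_superset:
  assumes "finite K" "Poly_Mapping.keys p \<subseteq> K" "K \<subseteq> S"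
  shows "eval_comb M f p = (\<Oplus>\<^bsub>M\<^esub>g\<in>K. Poly_Mapping.lookup p g \<odot>\<^bsub>M\<^esub> f g)"
  unfolding eval_comb_def
proof (rule add.finprod_mono_neutral_cong_left)
  show "Poly_Mapping.lookup p g \<odot>\<^bsub>M\<^esub> f g = \<zero>\<^bsub>M\<^esub>" if "g \<in> K - Poly_Mapping.keys p" for g
    using assms(3) f_closed smult_l_null that by (auto simp: in_keys_iff)
qed (use assms in \<open>auto intro: smult_f_closed\<close>)

lemma eval_add:
  assumes "Poly_Mapping.keys p \<subseteq> S" "Poly_Mapping.keys q \<subseteq> S"
  shows "eval_comb M f (p + q) = eval_comb M f p \<oplus>\<^bsub>M\<^esub> eval_comb M f q"
proof -
  let ?K = "Poly_Mapping.keys p \<union> Poly_Mapping.keys q"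
  have K: "finite ?K" "?K \<subseteq> S" using assms by auto
  have c: "(\<lambda>g. Poly_Mapping.lookup r g \<odot>\<^bsub>M\<^esub> f g) \<in> ?K \<rightarrow> carrier M" for r
    using K(2) smult_f_closed by blast
  have d: "Poly_Mapping.lookup (p + q) g \<odot>\<^bsub>M\<^esub> f g =
      Poly_Mapping.lookup p g \<odot>\<^bsub>M\<^esub> f g \<oplus>\<^bsub>M\<^esub> Poly_Mapping.lookup q g \<odot>\<^bsub>M\<^esub> f g" if "g \<in> ?K" for g
    using smult_l_distr f_closed K(2) that by (auto simp: lookup_add)
  have "eval_comb M f (p + q) = (\<Oplus>\<^bsub>M\<^esub>g\<in>?K.
      Poly_Mapping.lookup p g \<odot>\<^bsub>M\<^esub> f g \<oplus>\<^bsub>M\<^esub> Poly_Mapping.lookup q g \<odot>\<^bsub>M\<^esub> f g)"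
    unfolding eval_superset[OF K(1) Poly_Mapping.keys_add K(2)]
    by (rule finsum_cong'[OF refl _ d]) (use c in auto)
  then show ?thesis
    unfolding eval_superset[OF K(1) Un_upper1 K(2)] eval_superset[OF K(1) Un_upper2 K(2)]
    using finsum_addf[OF c c] by simp
qed

lemma eval_single: "g \<in> S \<Longrightarrow> eval_comb M f (Poly_Mapping.single g c) = c \<odot>\<^bsub>M\<^esub> f g"
  by (subst eval_superset[of "{g}"]) (auto simp: smult_f_closed)

lemma eval_zero [simp]: "eval_comb M f 0 = \<zero>\<^bsub>M\<^esub>"
  by (simp add: eval_comb_def)

lemma eval_scale:
  assumes "Poly_Mapping.keys p \<subseteq> S"
  shows "eval_comb M f (scale_comb c p) = c \<odot>\<^bsub>M\<^esub> eval_comb M f p"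
  using assms
proof (induction p rule: poly_mapping_additive_induct)
  case zero
  then show ?case by (simp add: smult_r_null)
next
  case (single g b)
  have "eval_comb M f (scale_comb c (Poly_Mapping.single g b)) = (c * b) \<odot>\<^bsub>M\<^esub> f g"
    by (simp only: scale_comb_single eval_single[OF single])
  also have "\<dots> = c \<odot>\<^bsub>M\<^esub> (b \<odot>\<^bsub>M\<^esub> f g)"
    using smult_assoc1[of c b "f g"] f_closed[OF single] by (simp only: ground_field_simps UNIV_I)
  finally show ?case by (simp only: eval_single[OF single])
next
  case (add p q)
  have k: "Poly_Mapping.keys (scale_comb c r) \<subseteq> S" if "Poly_Mapping.keys r \<subseteq> S" for r
    using that by (rule subset_trans[OF keys_scale_comb])
  have "eval_comb M f (scale_comb c (p + q)) = c \<odot>\<^bsub>M\<^esub> eval_comb M f p \<oplus>\<^bsub>M\<^esub> c \<odot>\<^bsub>M\<^esub> eval_comb M f q"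
    by (simp only: scale_comb_add eval_add[OF k[OF add(1)] k[OF add(2)]] add.IH)
  also have "\<dots> = c \<odot>\<^bsub>M\<^esub> eval_comb M f (p + q)"
    using smult_r_distr[of c] eval_closed[OF add(1)] eval_closed[OF add(2)]
    by (simp only: eval_add[OF add(1,2)] ground_field_simps(1) UNIV_I)
  finally show ?case .
qed

lemma eval_minus:
  assumes "Poly_Mapping.keys p \<subseteq> S" "Poly_Mapping.keys q \<subseteq> S"
  shows "eval_comb M f (p - q) = eval_comb M f p \<ominus>\<^bsub>M\<^esub> eval_comb M f q"
proof -
  have k: "Poly_Mapping.keys (p - q) \<subseteq> S"
    using assms Poly_Mapping.keys_diff[of p q] by blast
  show ?thesis
    using eval_add[OF k assms(2)] eval_closed[OF k] eval_closed[OF assms(1)] eval_closed[OF assms(2)]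
    by (simp add: a_minus_def a_assoc r_neg)
qed

end

section \<open>Presented vector spaces and algebras\<close>

lemma mem_coset: "q \<in> coset R p \<longleftrightarrow> q - p \<in> comb_span R"
  by (simp add: coset_def)

lemma self_mem_coset: "p \<in> coset R p"
  by (simp add: mem_coset comb_span_zero)

lemma coset_eq_iff: "coset R p = coset R q \<longleftrightarrow> p - q \<in> comb_span R"
proof
  assume "coset R p = coset R q"
  then show "p - q \<in> comb_span R" using self_mem_coset[of p R] by (simp add: mem_coset)
next
  assume pq: "p - q \<in> comb_span R"
  have "r - p \<in> comb_span R \<longleftrightarrow> r - q \<in> comb_span R" for r
    using comb_span_add[of "r - p" R "p - q"] comb_span_diff[of "r - q" R "p - q"] pq by auto
  then show "coset R p = coset R q" by (auto simp: coset_def)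
qed

lemma UN_coset:
  assumes "\<And>q. q \<in> coset R p \<Longrightarrow> F q = C"
  shows "(\<Union>q\<in>coset R p. F q) = C"
proof (rule SUP_eq_const)
  show "coset R p \<noteq> {}" using self_mem_coset[of p R] by blast
qed (rule assms)

lemma presented_carrier:
  "X \<in> carrier (presented_algebra S R m e) \<longleftrightarrow> (\<exists>p. Poly_Mapping.keys p \<subseteq> S \<and> X = coset R p)"
  by (auto simp: presented_algebra_def)

text \<open>The union in the definition of the sum is over equal cosets whatever the
  representatives, because the span of the relators is closed under addition.\<close>

lemma presented_add:
  "coset R p \<oplus>\<^bsub>presented_algebra S R m e\<^esub> coset R q = coset R (p + q)"
proof -
  have eq: "coset R (p' + q') = coset R (p + q)" if "p' \<in> coset R p" "q' \<in> coset R q" for p' q'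
  proof -
    have "(p' + q') - (p + q) = (p' - p) + (q' - q)" by simp
    then show ?thesis
      using comb_span_add[of "p' - p" R "q' - q"] that by (simp only: coset_eq_iff mem_coset)
  qed
  have "(\<Union>p'\<in>coset R p. \<Union>q'\<in>coset R q. coset R (p' + q')) = coset R (p + q)"
    by (rule UN_coset, rule UN_coset, rule eq)
  then show ?thesis
    by (simp add: presented_algebra_def)
qed

lemma presented_smult:
  "c \<odot>\<^bsub>presented_algebra S R m e\<^esub> coset R p = coset R (scale_comb c p)"
proof -
  have eq: "coset R (scale_comb c p') = coset R (scale_comb c p)" if "p' \<in> coset R p" for p'
  proof -
    have "scale_comb c p' - scale_comb c p = scale_comb c (p' - p)"
      using scale_comb_add[of c "p' - p" p] by simp
    then show ?thesis
      using comb_span_scale[of "p' - p" R c] that by (simp only: coset_eq_iff mem_coset)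
  qed
  have "(\<Union>p'\<in>coset R p. coset R (scale_comb c p')) = coset R (scale_comb c p)"
    by (rule UN_coset, rule eq)
  then show ?thesis
    by (simp add: presented_algebra_def)
qed

lemma presented_zero: "\<zero>\<^bsub>presented_algebra S R m e\<^esub> = coset R 0"
  and presented_one: "\<one>\<^bsub>presented_algebra S R m e\<^esub> = coset R (Poly_Mapping.single e 1)"
  by (simp_all add: presented_algebra_def)

lemma keys_add_subset:
  "Poly_Mapping.keys p \<subseteq> S \<Longrightarrow> Poly_Mapping.keys q \<subseteq> S \<Longrightarrow> Poly_Mapping.keys (p + q) \<subseteq> S"
  using Poly_Mapping.keys_add[of p q] by blast

lemma keys_scale_subset: "Poly_Mapping.keys p \<subseteq> S \<Longrightarrow> Poly_Mapping.keys (scale_comb c p) \<subseteq> S"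
  using keys_scale_comb[of c p] by blast

lemma coset_in_presented:
  "Poly_Mapping.keys p \<subseteq> S \<Longrightarrow> coset R p \<in> carrier (presented_algebra S R m e)"
  by (auto simp: presented_carrier)

lemma module_presented_algebra: "module ground_field (presented_algebra S R m e)"
proof -
  let ?P = "presented_algebra S R m e"
  note ops = presented_add presented_smult presented_zero coset_in_presented
    keys_add_subset keys_scale_subset
  have ex: "\<exists>p. Poly_Mapping.keys p \<subseteq> S \<and> X = coset R p" if "X \<in> carrier ?P" for X
    using that by (simp add: presented_carrier)
  have neg: "\<exists>Y\<in>carrier ?P. Y \<oplus>\<^bsub>?P\<^esub> X = \<zero>\<^bsub>?P\<^esub>" if X: "X \<in> carrier ?P" for X
  proof -
    obtain p where p: "Poly_Mapping.keys p \<subseteq> S" "X = coset R p" using ex[OF X] by blast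
    have "scale_comb (- 1) p + p = 0" by (rule poly_mapping_eqI) (simp add: lookup_add)
    then have "coset R (scale_comb (- 1) p) \<in> carrier ?P"
        "coset R (scale_comb (- 1) p) \<oplus>\<^bsub>?P\<^esub> X = \<zero>\<^bsub>?P\<^esub>"
      using p by (simp_all add: ops)
    then show ?thesis by blast
  qed
  have grp: "abelian_group ?P"
  proof (rule abelian_groupI)
    show "X \<oplus>\<^bsub>?P\<^esub> Y \<in> carrier ?P" if "X \<in> carrier ?P" "Y \<in> carrier ?P" for X Y
      using ex[OF that(1)] ex[OF that(2)] by (auto simp: ops)
    show "X \<oplus>\<^bsub>?P\<^esub> Y = Y \<oplus>\<^bsub>?P\<^esub> X" if "X \<in> carrier ?P" "Y \<in> carrier ?P" for X Y
      using ex[OF that(1)] ex[OF that(2)] by (auto simp: ops add.commute)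
    show "X \<oplus>\<^bsub>?P\<^esub> Y \<oplus>\<^bsub>?P\<^esub> Z = X \<oplus>\<^bsub>?P\<^esub> (Y \<oplus>\<^bsub>?P\<^esub> Z)"
      if "X \<in> carrier ?P" "Y \<in> carrier ?P" "Z \<in> carrier ?P" for X Y Z
      using ex[OF that(1)] ex[OF that(2)] ex[OF that(3)] by (auto simp: ops add.assoc)
    show "\<zero>\<^bsub>?P\<^esub> \<oplus>\<^bsub>?P\<^esub> X = X" if "X \<in> carrier ?P" for X
      using ex[OF that(1)] by (auto simp: ops)
    show "\<zero>\<^bsub>?P\<^esub> \<in> carrier ?P" by (simp add: ops)
  qed (rule neg)
  show ?thesis
  proof (rule module.intro[OF cring_ground_field grp], unfold_locales)
    fix a b :: 'a and X Y
    assume X: "X \<in> carrier ?P"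
    obtain p where p: "Poly_Mapping.keys p \<subseteq> S" "X = coset R p" using ex[OF X] by blast
    show "a \<odot>\<^bsub>?P\<^esub> X \<in> carrier ?P" using p by (simp add: ops)
    have "scale_comb (a + b) p = scale_comb a p + scale_comb b p"
      by (rule poly_mapping_eqI) (simp add: lookup_add distrib_right)
    then show "(a \<oplus>\<^bsub>ground_field\<^esub> b) \<odot>\<^bsub>?P\<^esub> X = a \<odot>\<^bsub>?P\<^esub> X \<oplus>\<^bsub>?P\<^esub> b \<odot>\<^bsub>?P\<^esub> X"
      using p by (simp add: ops)
    have "scale_comb (a * b) p = scale_comb a (scale_comb b p)"
      by (rule poly_mapping_eqI) (simp add: mult.assoc)
    then show "(a \<otimes>\<^bsub>ground_field\<^esub> b) \<odot>\<^bsub>?P\<^esub> X = a \<odot>\<^bsub>?P\<^esub> (b \<odot>\<^bsub>?P\<^esub> X)"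
      using p by (simp add: ops)
    have "scale_comb 1 p = p" by (rule poly_mapping_eqI) simp
    then show "\<one>\<^bsub>ground_field\<^esub> \<odot>\<^bsub>?P\<^esub> X = X" using p by (simp add: ops)
    assume Y: "Y \<in> carrier ?P"
    obtain q where q: "Poly_Mapping.keys q \<subseteq> S" "Y = coset R q" using ex[OF Y] by blast
    show "a \<odot>\<^bsub>?P\<^esub> (X \<oplus>\<^bsub>?P\<^esub> Y) = a \<odot>\<^bsub>?P\<^esub> X \<oplus>\<^bsub>?P\<^esub> a \<odot>\<^bsub>?P\<^esub> Y"
      using p q by (simp add: ops scale_comb_add)
  qed
qed

lemma presented_induct [consumes 1, case_names zero generator add]:
  assumes "X \<in> carrier (presented_algebra S R m e)"
    and "P \<zero>\<^bsub>presented_algebra S R m e\<^esub>"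
    and "\<And>c g. g \<in> S \<Longrightarrow> P (c \<odot>\<^bsub>presented_algebra S R m e\<^esub> coset R (Poly_Mapping.single g 1))"
    and "\<And>X Y. X \<in> carrier (presented_algebra S R m e) \<Longrightarrow> Y \<in> carrier (presented_algebra S R m e) \<Longrightarrow>
      P X \<Longrightarrow> P Y \<Longrightarrow> P (X \<oplus>\<^bsub>presented_algebra S R m e\<^esub> Y)"
  shows "P X"
proof -
  obtain p where p: "Poly_Mapping.keys p \<subseteq> S" and X: "X = coset R p"
    using assms(1) by (auto simp: presented_carrier)
  from p have "P (coset R p)"
  proof (induction p rule: poly_mapping_additive_induct)
    case zero
    then show ?case using assms(2) by (simp add: presented_zero)
  next
    case (single g c)
    then show ?case using assms(3)[of g c] by (simp add: presented_smult)
  next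
    case (add p q)
    then show ?case
      using assms(4)[of "coset R p" "coset R q"] by (simp add: presented_add coset_in_presented)
  qed
  then show ?thesis by (simp add: X)
qed

text \<open>Relators supported on the generators keep all representatives of an element of the
  quotient supported there as well; only then can a map given on the generators be evaluated on
  every representative.\<close>

locale presentation =
  fixes S :: "'g set" and R :: "('g \<Rightarrow>\<^sub>0 'k::field) set"
  assumes keys_relator: "r \<in> R \<Longrightarrow> Poly_Mapping.keys r \<subseteq> S"
begin

lemma keys_span: "r \<in> comb_span R \<Longrightarrow> Poly_Mapping.keys r \<subseteq> S"
  by (induction rule: comb_span_induct)
    (simp_all add: keys_add_subset keys_scale_subset keys_relator)

lemma keys_coset: "Poly_Mapping.keys p \<subseteq> S \<Longrightarrow> q \<in> coset R p \<Longrightarrow> Poly_Mapping.keys q \<subseteq> S"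
  using keys_add_subset[of "q - p" S p] keys_span by (simp add: mem_coset)

end

text \<open>The universal property of a presented space: a map on generators whose linear extension
  kills the relators induces a linear map on the quotient.\<close>

locale factoring_evaluation = presentation S R + evaluation M S f
  for S :: "'g set" and R :: "('g \<Rightarrow>\<^sub>0 'k::field) set" and M :: "('k, 'm) module" and f +
  assumes eval_relator: "r \<in> R \<Longrightarrow> eval_comb M f r = \<zero>\<^bsub>M\<^esub>"
begin

lemma eval_span: "r \<in> comb_span R \<Longrightarrow> eval_comb M f r = \<zero>\<^bsub>M\<^esub>"
proof -
  assume "r \<in> comb_span R"
  then have "eval_comb M f r = \<zero>\<^bsub>M\<^esub> \<and> Poly_Mapping.keys r \<subseteq> S"
    by (induction rule: comb_span_induct)
      (simp_all add: eval_add keys_scale_subset eval_scale eval_relator keys_relator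
        smult_r_null keys_add_subset)
  then show ?thesis ..
qed

lemma lin_ext_coset:
  assumes p: "Poly_Mapping.keys p \<subseteq> S"
  shows "lin_ext M f (coset R p) = eval_comb M f p"
proof -
  have eq: "eval_comb M f q = eval_comb M f p" if q: "q \<in> coset R p" for q
  proof -
    have d: "q - p \<in> comb_span R" using q by (simp add: mem_coset)
    show ?thesis
      using eval_add[OF keys_span[OF d] p] eval_span[OF d] eval_closed[OF p] by simp
  qed
  have "the_elem (eval_comb M f ` coset R p) = eval_comb M f p"
  proof (rule the_elem_image_unique)
    show "coset R p \<noteq> {}" using self_mem_coset[of p R] by blast
  qed (rule eq)
  then show ?thesis by (simp add: lin_ext_def eval_comb_def[abs_def])
qed

lemma lin_ext_generator: "g \<in> S \<Longrightarrow> lin_ext M f (coset R (Poly_Mapping.single g 1)) = f g"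
  using f_closed smult_one by (subst lin_ext_coset) (auto simp: eval_single)

lemma lin_ext_lin_map: "lin_map (presented_algebra S R m e) M (lin_ext M f)"
  by (rule lin_mapI) (auto simp: presented_carrier lin_ext_coset presented_add presented_smult
      keys_add_subset keys_scale_subset eval_closed eval_add eval_scale)

end

text \<open>Products of tensors are well defined once both factors have bilinear products. The tensor
  algebra belongs to this class, and the class is closed under tensor products, so that it
  contains the joint tensor algebra and its tensor square.\<close>

locale bilinear_algebra = module ground_field A for A :: "('k::field, 'a) module" +
  assumes algebra_one_closed: "\<one>\<^bsub>A\<^esub> \<in> carrier A"
    and mult_bilin: "bilin_map A A A (\<lambda>x y. x \<otimes>\<^bsub>A\<^esub> y)"
begin

lemmas algebra_mult_closed = bilin_mapD(3)[OF mult_bilin]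
  and algebra_add_mult = lin_mapD(2)[OF bilin_mapD(2)[OF mult_bilin]]
  and algebra_mult_add = lin_mapD(2)[OF bilin_mapD(1)[OF mult_bilin]]
  and algebra_smult_mult = lin_mapD(3)[OF bilin_mapD(2)[OF mult_bilin]]
  and algebra_mult_smult = lin_mapD(3)[OF bilin_mapD(1)[OF mult_bilin]]

lemma algebra_module: "module ground_field A" ..

end

text \<open>When the product of a relator with a generator is a consequence of the relators, the span
  of the relators is an ideal and the product of cosets is well defined.\<close>

locale presented_product = presentation S R
  for S :: "'g set" and R :: "('g \<Rightarrow>\<^sub>0 'k::field) set" +
  fixes m :: "'g \<Rightarrow> 'g \<Rightarrow> 'g" and e :: 'g
  assumes m_closed: "g \<in> S \<Longrightarrow> h \<in> S \<Longrightarrow> m g h \<in> S"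
    and e_closed: "e \<in> S"
    and relator_mult: "r \<in> R \<Longrightarrow> g \<in> S \<Longrightarrow> comb_mult m r (Poly_Mapping.single g 1) \<in> comb_span R"
    and mult_relator: "r \<in> R \<Longrightarrow> g \<in> S \<Longrightarrow> comb_mult m (Poly_Mapping.single g 1) r \<in> comb_span R"
begin

lemma comb_mult_span:
  assumes r: "r \<in> comb_span R" and "Poly_Mapping.keys p \<subseteq> S"
  shows "comb_mult m r p \<in> comb_span R" "comb_mult m p r \<in> comb_span R"
proof -
  have sc: "Poly_Mapping.single g c = scale_comb c (Poly_Mapping.single g 1)" for g and c :: 'k
    by simp
  have "comb_mult m r p \<in> comb_span R \<and> comb_mult m p r \<in> comb_span R" if r: "r \<in> R" for r
    using assms(2)
  proof (induction p rule: poly_mapping_additive_induct)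
    case zero
    then show ?case by (simp add: comb_span_zero)
  next
    case (single g c)
    then show ?case
      unfolding sc[of g c] comb_mult_scale_left comb_mult_scale_right
      using r by (blast intro: comb_span_scale relator_mult mult_relator)
  next
    case (add p q)
    then show ?case by (simp add: comb_mult_add_left comb_mult_add_right comb_span_add)
  qed
  note rel = this
  have "comb_mult m r p \<in> comb_span R \<and> comb_mult m p r \<in> comb_span R"
    using r by (induction rule: comb_span_induct)
      (simp_all add: comb_span_zero comb_mult_add_left comb_mult_add_right
        comb_mult_scale_left comb_mult_scale_right comb_span_add comb_span_scale rel)
  then show "comb_mult m r p \<in> comb_span R" "comb_mult m p r \<in> comb_span R" by auto
qed

lemma presented_mult:
  assumes p: "Poly_Mapping.keys p \<subseteq> S" and q: "Poly_Mapping.keys q \<subseteq> S"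
  shows "coset R p \<otimes>\<^bsub>presented_algebra S R m e\<^esub> coset R q = coset R (comb_mult m p q)"
proof -
  have eq: "coset R (comb_mult m p' q') = coset R (comb_mult m p q)"
    if p': "p' \<in> coset R p" and q': "q' \<in> coset R q" for p' q'
  proof -
    have "comb_mult m p' q' - comb_mult m p q =
        comb_mult m (p' - p) q' + comb_mult m p (q' - q)"
      by (simp add: comb_mult_minus_left comb_mult_minus_right)
    also have "\<dots> \<in> comb_span R"
      using p' q' unfolding mem_coset
      by (intro comb_span_add comb_mult_span(1)[OF _ keys_coset[OF q q']] comb_mult_span(2)[OF _ p])
    finally show ?thesis by (simp only: coset_eq_iff)
  qed
  have "(\<Union>p'\<in>coset R p. \<Union>q'\<in>coset R q. coset R (comb_mult m p' q')) =
      coset R (comb_mult m p q)"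
    by (rule UN_coset, rule UN_coset, rule eq)
  then show ?thesis
    by (simp add: presented_algebra_def)
qed

lemma presented_mult_generators:
  "g \<in> S \<Longrightarrow> h \<in> S \<Longrightarrow>
    coset R (Poly_Mapping.single g 1) \<otimes>\<^bsub>presented_algebra S R m e\<^esub> coset R (Poly_Mapping.single h 1)
      = coset R (Poly_Mapping.single (m g h) 1)"
  by (simp add: presented_mult comb_mult_single)

lemma bilinear_presented_algebra: "bilinear_algebra (presented_algebra S R m e)"
proof (intro bilinear_algebra.intro module_presented_algebra bilinear_algebra_axioms.intro)
  show "\<one>\<^bsub>presented_algebra S R m e\<^esub> \<in> carrier (presented_algebra S R m e)"
    using e_closed by (simp add: presented_one coset_in_presented)
  have "\<exists>r. Poly_Mapping.keys r \<subseteq> S \<and> coset R (comb_mult m p q) = coset R r"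
    if "Poly_Mapping.keys p \<subseteq> S" "Poly_Mapping.keys q \<subseteq> S" for p q
    using keys_comb_mult[where m = m, OF that m_closed] by blast
  then show "bilin_map (presented_algebra S R m e) (presented_algebra S R m e)
      (presented_algebra S R m e) (\<otimes>\<^bsub>presented_algebra S R m e\<^esub>)"
    by (intro bilin_mapI lin_mapI)
      (auto simp: presented_carrier presented_mult presented_add presented_smult
        keys_add_subset keys_scale_subset comb_mult_add_left comb_mult_add_right
        comb_mult_scale_left comb_mult_scale_right)
qed

end

section \<open>Tensor products\<close>

lemma (in abelian_group) minus_self: "x \<in> carrier G \<Longrightarrow> x \<ominus> x = \<zero>"
  by (simp add: a_minus_def r_neg)

lemma (in abelian_group) add_minus_minus:
  assumes "x \<in> carrier G" "y \<in> carrier G"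
  shows "x \<oplus> y \<ominus> x \<ominus> y = \<zero>"
proof -
  have "x \<oplus> y \<ominus> x \<ominus> y = (x \<oplus> y) \<ominus> (x \<oplus> y)"
    using assms by (simp add: a_minus_def minus_add a_assoc)
  then show ?thesis using assms by (simp add: minus_self)
qed

lemma keys_minus_subset:
  "Poly_Mapping.keys p \<subseteq> S \<Longrightarrow> Poly_Mapping.keys q \<subseteq> S \<Longrightarrow> Poly_Mapping.keys (p - q) \<subseteq> S"
  using Poly_Mapping.keys_diff[of p q] by blast

lemma keys_single_subset: "g \<in> S \<Longrightarrow> Poly_Mapping.keys (Poly_Mapping.single g c) \<subseteq> S"
  by auto

lemma bilinear_relators_cases [consumes 1, case_names add_left add_right smult_left smult_right]:
  assumes "r \<in> bilinear_relators A B"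
  obtains
    a a' b where "a \<in> carrier A" "a' \<in> carrier A" "b \<in> carrier B"
      "r = Poly_Mapping.single (a \<oplus>\<^bsub>A\<^esub> a', b) 1 - Poly_Mapping.single (a, b) 1
        - Poly_Mapping.single (a', b) 1"
  | a b b' where "a \<in> carrier A" "b \<in> carrier B" "b' \<in> carrier B"
      "r = Poly_Mapping.single (a, b \<oplus>\<^bsub>B\<^esub> b') 1 - Poly_Mapping.single (a, b) 1
        - Poly_Mapping.single (a, b') 1"
  | c a b where "a \<in> carrier A" "b \<in> carrier B"
      "r = Poly_Mapping.single (c \<odot>\<^bsub>A\<^esub> a, b) 1 - Poly_Mapping.single (a, b) c"
  | c a b where "a \<in> carrier A" "b \<in> carrier B"
      "r = Poly_Mapping.single (a, c \<odot>\<^bsub>B\<^esub> b) 1 - Poly_Mapping.single (a, b) c"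
  using assms unfolding bilinear_relators_def by blast

lemma bilinear_relatorsI:
  "a \<in> carrier A \<Longrightarrow> a' \<in> carrier A \<Longrightarrow> b \<in> carrier B \<Longrightarrow>
    Poly_Mapping.single (a \<oplus>\<^bsub>A\<^esub> a', b) 1 - Poly_Mapping.single (a, b) 1 - Poly_Mapping.single (a', b) 1
      \<in> bilinear_relators A B"
  "a \<in> carrier A \<Longrightarrow> b \<in> carrier B \<Longrightarrow> b' \<in> carrier B \<Longrightarrow>
    Poly_Mapping.single (a, b \<oplus>\<^bsub>B\<^esub> b') 1 - Poly_Mapping.single (a, b) 1 - Poly_Mapping.single (a, b') 1
      \<in> bilinear_relators A B"
  "a \<in> carrier A \<Longrightarrow> b \<in> carrier B \<Longrightarrow>
    Poly_Mapping.single (c \<odot>\<^bsub>A\<^esub> a, b) 1 - Poly_Mapping.single (a, b) c \<in> bilinear_relators A B"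
  "a \<in> carrier A \<Longrightarrow> b \<in> carrier B \<Longrightarrow>
    Poly_Mapping.single (a, c \<odot>\<^bsub>B\<^esub> b) 1 - Poly_Mapping.single (a, b) c \<in> bilinear_relators A B"
  unfolding bilinear_relators_def by blast+

text \<open>Since both carriers are closed under the module operations, the bilinear relators only
  involve pairs of elements, so that tensor products have the universal property of presented
  spaces.\<close>

locale module_pair = A: module ground_field A + B: module ground_field B
  for A :: "('k::field, 'a) module" and B :: "('k, 'b) module"
begin

lemma smult_A_closed: "a \<in> carrier A \<Longrightarrow> c \<odot>\<^bsub>A\<^esub> a \<in> carrier A"
  and smult_B_closed: "b \<in> carrier B \<Longrightarrow> c \<odot>\<^bsub>B\<^esub> b \<in> carrier B"
  by simp_all

sublocale presentation "carrier A \<times> carrier B" "bilinear_relators A B"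
proof
  fix r :: "'a \<times> 'b \<Rightarrow>\<^sub>0 'k" assume "r \<in> bilinear_relators A B"
  then show "Poly_Mapping.keys r \<subseteq> carrier A \<times> carrier B"
    by (cases rule: bilinear_relators_cases)
      (simp_all add: keys_minus_subset smult_A_closed smult_B_closed)
qed

lemma pure_closed: "a \<in> carrier A \<Longrightarrow> b \<in> carrier B \<Longrightarrow>
    pure_tensor A B a b \<in> carrier (tensor_product A B)"
  by (simp add: pure_tensor_def tensor_product_def coset_in_presented)

lemma module_tensor_product: "module ground_field (tensor_product A B)"
  unfolding tensor_product_def by (rule module_presented_algebra)

lemma pure_bilin: "bilin_map A B (tensor_product A B) (pure_tensor A B)"
proof (intro bilin_mapI lin_mapI pure_closed)
  fix a b b' and c :: 'k assume a: "a \<in> carrier A" and b: "b \<in> carrier B"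
  show "pure_tensor A B a (c \<odot>\<^bsub>B\<^esub> b) = c \<odot>\<^bsub>tensor_product A B\<^esub> pure_tensor A B a b"
    using comb_span_base[OF bilinear_relatorsI(4)[OF a b, of c]]
    by (simp add: pure_tensor_def tensor_product_def presented_smult coset_eq_iff)
  assume b': "b' \<in> carrier B"
  show "pure_tensor A B a (b \<oplus>\<^bsub>B\<^esub> b') =
      pure_tensor A B a b \<oplus>\<^bsub>tensor_product A B\<^esub> pure_tensor A B a b'"
    using comb_span_base[OF bilinear_relatorsI(2)[OF a b b']]
    by (simp add: pure_tensor_def tensor_product_def presented_add coset_eq_iff diff_diff_eq)
next
  fix a a' b and c :: 'k assume b: "b \<in> carrier B" and a: "a \<in> carrier A"
  show "pure_tensor A B (c \<odot>\<^bsub>A\<^esub> a) b = c \<odot>\<^bsub>tensor_product A B\<^esub> pure_tensor A B a b"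
    using comb_span_base[OF bilinear_relatorsI(3)[OF a b, of c]]
    by (simp add: pure_tensor_def tensor_product_def presented_smult coset_eq_iff)
  assume a': "a' \<in> carrier A"
  show "pure_tensor A B (a \<oplus>\<^bsub>A\<^esub> a') b =
      pure_tensor A B a b \<oplus>\<^bsub>tensor_product A B\<^esub> pure_tensor A B a' b"
    using comb_span_base[OF bilinear_relatorsI(1)[OF a a' b]]
    by (simp add: pure_tensor_def tensor_product_def presented_add coset_eq_iff diff_diff_eq)
qed

lemma tensor_induct [consumes 1, case_names zero pure add]:
  assumes "D \<in> carrier (tensor_product A B)"
    and "P \<zero>\<^bsub>tensor_product A B\<^esub>"
    and "\<And>c a b. a \<in> carrier A \<Longrightarrow> b \<in> carrier B \<Longrightarrow>
      P (c \<odot>\<^bsub>tensor_product A B\<^esub> pure_tensor A B a b)"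
    and "\<And>D E. D \<in> carrier (tensor_product A B) \<Longrightarrow> E \<in> carrier (tensor_product A B) \<Longrightarrow>
      P D \<Longrightarrow> P E \<Longrightarrow> P (D \<oplus>\<^bsub>tensor_product A B\<^esub> E)"
  shows "P D"
  using assms(1)[unfolded tensor_product_def]
proof (induction rule: presented_induct)
  case zero
  show ?case using assms(2) by (simp add: tensor_product_def)
next
  case (generator c g)
  then show ?case using assms(3)[of "fst g" "snd g" c]
    by (auto simp: tensor_product_def pure_tensor_def)
next
  case (add X Y)
  then show ?case using assms(4)[of X Y] by (simp add: tensor_product_def)
qed

text \<open>Each of the four kinds of relators expresses one of the identities of a bilinear map.\<close>

lemma factoring_bilin:
  assumes M: "module ground_field M" and f: "bilin_map A B M f"
  shows "factoring_evaluation (carrier A \<times> carrier B) (bilinear_relators A B) M (\<lambda>(a, b). f a b)"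
proof -
  interpret M: module ground_field M by fact
  interpret evaluation M "carrier A \<times> carrier B" "\<lambda>(a, b). f a b"
    by unfold_locales (auto intro: bilin_mapD(3)[OF f])
  note fc = bilin_mapD(3)[OF f]
  show ?thesis
  proof unfold_locales
    fix r :: "'a \<times> 'b \<Rightarrow>\<^sub>0 'k" assume "r \<in> bilinear_relators A B"
    then show "eval_comb M (\<lambda>(a, b). f a b) r = \<zero>\<^bsub>M\<^esub>"
    proof (cases rule: bilinear_relators_cases)
      case (add_left a a' b)
      then show ?thesis
        by (simp add: eval_minus eval_single keys_minus_subset keys_single_subset
            lin_mapD(2)[OF bilin_mapD(2)[OF f]] fc M.add_minus_minus M.smult_one[simplified])
    next
      case (add_right a b b')
      then show ?thesis
        by (simp add: eval_minus eval_single keys_minus_subset keys_single_subset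
            lin_mapD(2)[OF bilin_mapD(1)[OF f]] fc M.add_minus_minus M.smult_one[simplified])
    next
      case (smult_left c a b)
      then show ?thesis
        by (simp add: eval_minus eval_single keys_single_subset smult_A_closed
            lin_mapD(3)[OF bilin_mapD(2)[OF f]] fc M.minus_self M.smult_one[simplified])
    next
      case (smult_right c a b)
      then show ?thesis
        by (simp add: eval_minus eval_single keys_single_subset smult_B_closed
            lin_mapD(3)[OF bilin_mapD(1)[OF f]] fc M.minus_self M.smult_one[simplified])
    qed
  qed
qed

lemma sweedler_lin_map:
  assumes "module ground_field M" and "bilin_map A B M f"
  shows "lin_map (tensor_product A B) M (sweedler M f)"
  using factoring_evaluation.lin_ext_lin_map[OF factoring_bilin[OF assms]]
  by (simp add: sweedler_def[abs_def] tensor_product_def)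

lemma sweedler_pure:
  assumes "module ground_field M" and "bilin_map A B M f" and "a \<in> carrier A" "b \<in> carrier B"
  shows "sweedler M f (pure_tensor A B a b) = f a b"
  using factoring_evaluation.lin_ext_generator[OF factoring_bilin[OF assms(1,2)], of "(a, b)"]
    assms(3,4)
  by (simp add: sweedler_def pure_tensor_def)

text \<open>Sweedler sums depend linearly on parameters of the summand. By induction on tensors: on a
  pure tensor the sum is a value of the summand, and linear maps are closed under linear
  combinations.\<close>

lemma sweedler_parameter:
  assumes M: "module ground_field M" and P: "module ground_field P"
    and f: "\<And>x. x \<in> carrier P \<Longrightarrow> bilin_map A B M (f x)"
    and lin: "\<And>a b. a \<in> carrier A \<Longrightarrow> b \<in> carrier B \<Longrightarrow> lin_map P M (\<lambda>x. f x a b)"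
    and D: "D \<in> carrier (tensor_product A B)"
  shows "lin_map P M (\<lambda>x. sweedler M (f x) D)"
  using D
proof (induction rule: tensor_induct)
  interpret M: module ground_field M by fact
  interpret P: module ground_field P by fact
  case zero
  have "lin_map P M (\<lambda>x. \<zero>\<^bsub>M\<^esub>)" by (rule lin_mapI) (simp_all add: M.smult_r_null)
  then show ?case
    by (rule lin_map_cong[rotated])
      (simp_all add: P lin_map_zero[OF sweedler_lin_map[OF M f] module_tensor_product M])
next
  case (pure c a b)
  show ?case
    by (rule lin_map_cong[OF _ lin_map_smult[OF lin[OF pure] M, of c] P])
      (simp add: lin_mapD(3)[OF sweedler_lin_map[OF M f]] pure_closed pure sweedler_pure[OF M f])
next
  case (add D E)
  show ?case
    by (rule lin_map_cong[OF _ lin_map_add[OF add.IH M] P])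
      (simp add: lin_mapD(2)[OF sweedler_lin_map[OF M f]] add.hyps)
qed

end

text \<open>For bilinear products, multiplying a relator of the tensor product by a pure tensor gives
  a relator of the same kind, so that products of tensors are well defined.\<close>

locale algebra_pair = A: bilinear_algebra A + B: bilinear_algebra B
  for A :: "('k::field, 'a) module" and B :: "('k, 'b) module"
begin

sublocale module_pair A B ..

sublocale presented_product "carrier A \<times> carrier B" "bilinear_relators A B"
  "\<lambda>(a, b) (a', b'). (a \<otimes>\<^bsub>A\<^esub> a', b \<otimes>\<^bsub>B\<^esub> b')" "(\<one>\<^bsub>A\<^esub>, \<one>\<^bsub>B\<^esub>)"
proof
  note mult = comb_mult_minus_left comb_mult_minus_right comb_mult_single split_def
    A.algebra_mult_closed A.algebra_add_mult A.algebra_mult_add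
    A.algebra_smult_mult A.algebra_mult_smult
    B.algebra_mult_closed B.algebra_add_mult B.algebra_mult_add
    B.algebra_smult_mult B.algebra_mult_smult
  fix g assume g: "g \<in> carrier A \<times> carrier B"
  fix r :: "'a \<times> 'b \<Rightarrow>\<^sub>0 'k" assume "r \<in> bilinear_relators A B"
  then have "comb_mult (\<lambda>(a, b) (a', b'). (a \<otimes>\<^bsub>A\<^esub> a', b \<otimes>\<^bsub>B\<^esub> b')) r (Poly_Mapping.single g 1)
      \<in> bilinear_relators A B \<and>
    comb_mult (\<lambda>(a, b) (a', b'). (a \<otimes>\<^bsub>A\<^esub> a', b \<otimes>\<^bsub>B\<^esub> b')) (Poly_Mapping.single g 1) r
      \<in> bilinear_relators A B"
    using g by (cases rule: bilinear_relators_cases) (auto simp: mult intro!: bilinear_relatorsI)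
  then show "comb_mult (\<lambda>(a, b) (a', b'). (a \<otimes>\<^bsub>A\<^esub> a', b \<otimes>\<^bsub>B\<^esub> b')) r (Poly_Mapping.single g 1)
      \<in> comb_span (bilinear_relators A B)"
    "comb_mult (\<lambda>(a, b) (a', b'). (a \<otimes>\<^bsub>A\<^esub> a', b \<otimes>\<^bsub>B\<^esub> b')) (Poly_Mapping.single g 1) r
      \<in> comb_span (bilinear_relators A B)"
    by (auto intro: comb_span_base)
qed (auto simp: A.algebra_mult_closed B.algebra_mult_closed A.algebra_one_closed B.algebra_one_closed)

lemma bilinear_tensor_product: "bilinear_algebra (tensor_product A B)"
  unfolding tensor_product_def by (rule bilinear_presented_algebra)

lemma pure_mult:
  "a \<in> carrier A \<Longrightarrow> b \<in> carrier B \<Longrightarrow> a' \<in> carrier A \<Longrightarrow> b' \<in> carrier B \<Longrightarrow>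
    pure_tensor A B a b \<otimes>\<^bsub>tensor_product A B\<^esub> pure_tensor A B a' b' =
      pure_tensor A B (a \<otimes>\<^bsub>A\<^esub> a') (b \<otimes>\<^bsub>B\<^esub> b')"
  using presented_mult_generators[of "(a, b)" "(a', b')"]
  by (simp add: pure_tensor_def tensor_product_def)

lemma tensor_product_one: "\<one>\<^bsub>tensor_product A B\<^esub> = pure_tensor A B \<one>\<^bsub>A\<^esub> \<one>\<^bsub>B\<^esub>"
  by (simp add: pure_tensor_def tensor_product_def presented_one)

end

section \<open>The tensor algebra\<close>

definition word :: "('k::field, 'u) module \<Rightarrow> 'u list \<Rightarrow> ('u list \<Rightarrow>\<^sub>0 'k) set" where
  "word U w = coset (multilinear_relators U) (Poly_Mapping.single w 1)"

lemma multilinear_relators_cases [consumes 1, case_names add smult]: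
  assumes "r \<in> multilinear_relators U"
  obtains
    v w x y where "v \<in> lists (carrier U)" "w \<in> lists (carrier U)" "x \<in> carrier U" "y \<in> carrier U"
      "r = Poly_Mapping.single (v @ [x \<oplus>\<^bsub>U\<^esub> y] @ w) 1 - Poly_Mapping.single (v @ [x] @ w) 1
        - Poly_Mapping.single (v @ [y] @ w) 1"
  | v w c x where "v \<in> lists (carrier U)" "w \<in> lists (carrier U)" "x \<in> carrier U"
      "r = Poly_Mapping.single (v @ [c \<odot>\<^bsub>U\<^esub> x] @ w) 1 - Poly_Mapping.single (v @ [x] @ w) c"
  using assms unfolding multilinear_relators_def by blast

lemma multilinear_relatorsI:
  "v \<in> lists (carrier U) \<Longrightarrow> w \<in> lists (carrier U) \<Longrightarrow> x \<in> carrier U \<Longrightarrow> y \<in> carrier U \<Longrightarrow>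
    Poly_Mapping.single (v @ [x \<oplus>\<^bsub>U\<^esub> y] @ w) 1 - Poly_Mapping.single (v @ [x] @ w) 1
      - Poly_Mapping.single (v @ [y] @ w) 1 \<in> multilinear_relators U"
  "v \<in> lists (carrier U) \<Longrightarrow> w \<in> lists (carrier U) \<Longrightarrow> x \<in> carrier U \<Longrightarrow>
    Poly_Mapping.single (v @ [c \<odot>\<^bsub>U\<^esub> x] @ w) 1 - Poly_Mapping.single (v @ [x] @ w) c
      \<in> multilinear_relators U"
  unfolding multilinear_relators_def by blast+

text \<open>The relators of the tensor algebra may carry arbitrary words on both sides of the letter
  that is varied; hence they are closed under concatenation with words.\<close>

locale ground_module = U: module ground_field U for U :: "('k::field, 'u) module"
begin

lemma smult_U_closed: "x \<in> carrier U \<Longrightarrow> c \<odot>\<^bsub>U\<^esub> x \<in> carrier U"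
  by simp

sublocale presented_product "lists (carrier U)" "multilinear_relators U" "(@)" "[]"
proof
  fix r :: "'u list \<Rightarrow>\<^sub>0 'k" assume r: "r \<in> multilinear_relators U"
  then show "Poly_Mapping.keys r \<subseteq> lists (carrier U)"
    by (cases rule: multilinear_relators_cases)
      (simp_all add: keys_minus_subset smult_U_closed)
  fix g assume g: "g \<in> lists (carrier U)"
  from r have "comb_mult (@) r (Poly_Mapping.single g 1) \<in> multilinear_relators U"
  proof (cases rule: multilinear_relators_cases)
    case (add v w x y)
    then show ?thesis
      using multilinear_relatorsI(1)[of v U "w @ g" x y] g
      by (simp add: comb_mult_minus_left comb_mult_single)
  next
    case (smult v w c x)
    then show ?thesis
      using multilinear_relatorsI(2)[of v U "w @ g" x c] g
      by (simp add: comb_mult_minus_left comb_mult_single)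
  qed
  then show "comb_mult (@) r (Poly_Mapping.single g 1) \<in> comb_span (multilinear_relators U)"
    by (rule comb_span_base)
  from r have "comb_mult (@) (Poly_Mapping.single g 1) r \<in> multilinear_relators U"
  proof (cases rule: multilinear_relators_cases)
    case (add v w x y)
    then show ?thesis
      using multilinear_relatorsI(1)[of "g @ v" U w x y] g
      by (simp add: comb_mult_minus_right comb_mult_single)
  next
    case (smult v w c x)
    then show ?thesis
      using multilinear_relatorsI(2)[of "g @ v" U w x c] g
      by (simp add: comb_mult_minus_right comb_mult_single)
  qed
  then show "comb_mult (@) (Poly_Mapping.single g 1) r \<in> comb_span (multilinear_relators U)"
    by (rule comb_span_base)
qed auto

lemma bilinear_tensor_algebra: "bilinear_algebra (tensor_algebra U)"
  unfolding tensor_algebra_def by (rule bilinear_presented_algebra)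

lemma word_closed: "w \<in> lists (carrier U) \<Longrightarrow> word U w \<in> carrier (tensor_algebra U)"
  by (simp add: word_def tensor_algebra_def coset_in_presented)

lemma word_mult:
  "v \<in> lists (carrier U) \<Longrightarrow> w \<in> lists (carrier U) \<Longrightarrow>
    word U v \<otimes>\<^bsub>tensor_algebra U\<^esub> word U w = word U (v @ w)"
  by (simp add: word_def tensor_algebra_def presented_mult_generators)

lemma tensor_algebra_one: "\<one>\<^bsub>tensor_algebra U\<^esub> = word U []"
  by (simp add: word_def tensor_algebra_def presented_one)

lemma tensor_inj_eq_word: "tensor_inj U x = word U [x]"
  by (simp add: tensor_inj_def word_def)

lemma tensor_inj_lin_map: "lin_map U (tensor_algebra U) (tensor_inj U)"
proof (rule lin_mapI)
  fix x y and c :: 'k assume x: "x \<in> carrier U"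
  then show "tensor_inj U x \<in> carrier (tensor_algebra U)"
    by (simp add: tensor_inj_eq_word word_closed)
  show "tensor_inj U (c \<odot>\<^bsub>U\<^esub> x) = c \<odot>\<^bsub>tensor_algebra U\<^esub> tensor_inj U x"
    using comb_span_base[OF multilinear_relatorsI(2)[OF _ _ x, of "[]" "[]" c]]
    by (simp add: tensor_inj_def tensor_algebra_def presented_smult coset_eq_iff)
  assume y: "y \<in> carrier U"
  show "tensor_inj U (x \<oplus>\<^bsub>U\<^esub> y) = tensor_inj U x \<oplus>\<^bsub>tensor_algebra U\<^esub> tensor_inj U y"
    using comb_span_base[OF multilinear_relatorsI(1)[OF _ _ x y, of "[]" "[]"]]
    by (simp add: tensor_inj_def tensor_algebra_def presented_add coset_eq_iff diff_diff_eq)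
qed

lemma tensor_algebra_induct [consumes 1, case_names zero word add]:
  assumes "X \<in> carrier (tensor_algebra U)"
    and "P \<zero>\<^bsub>tensor_algebra U\<^esub>"
    and "\<And>c w. w \<in> lists (carrier U) \<Longrightarrow> P (c \<odot>\<^bsub>tensor_algebra U\<^esub> word U w)"
    and "\<And>X Y. X \<in> carrier (tensor_algebra U) \<Longrightarrow> Y \<in> carrier (tensor_algebra U) \<Longrightarrow>
      P X \<Longrightarrow> P Y \<Longrightarrow> P (X \<oplus>\<^bsub>tensor_algebra U\<^esub> Y)"
  shows "P X"
  using assms(1)[unfolded tensor_algebra_def]
  by (induction rule: presented_induct) (simp_all add: assms[unfolded tensor_algebra_def word_def])

lemma factoring_multilinear:
  assumes M: "module ground_field M"
    and closed: "\<And>w. w \<in> lists (carrier U) \<Longrightarrow> f w \<in> carrier M"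
    and lin: "\<And>v w. v \<in> lists (carrier U) \<Longrightarrow> w \<in> lists (carrier U) \<Longrightarrow>
      lin_map U M (\<lambda>x. f (v @ [x] @ w))"
  shows "factoring_evaluation (lists (carrier U)) (multilinear_relators U) M f"
proof -
  interpret M: module ground_field M by fact
  interpret evaluation M "lists (carrier U)" f
    by unfold_locales (rule closed)
  show ?thesis
  proof unfold_locales
    fix r :: "'u list \<Rightarrow>\<^sub>0 'k" assume "r \<in> multilinear_relators U"
    then show "eval_comb M f r = \<zero>\<^bsub>M\<^esub>"
    proof (cases rule: multilinear_relators_cases)
      case (add v w x y)
      then show ?thesis
        using lin_mapD(2)[OF lin[of v w], of x y] closed[of "v @ [x] @ w"] closed[of "v @ [y] @ w"]
        by (simp add: eval_minus eval_single keys_minus_subset keys_single_subset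
            M.add_minus_minus M.smult_one[simplified])
    next
      case (smult v w c x)
      then show ?thesis
        using lin_mapD(3)[OF lin[of v w], of x c] closed[of "v @ [x] @ w"]
        by (simp add: eval_minus eval_single keys_single_subset smult_U_closed
            M.minus_self M.smult_one[simplified])
    qed
  qed
qed

end

section \<open>Sums over the splittings of a word\<close>

text \<open>The sum of \<open>f a b\<close> over all \<open>2\<^sup>n\<close> ways to distribute the letters of a word of length \<open>n\<close>
  over two subwords \<open>a\<close> and \<open>b\<close> in their original order: the co-multiplication of the word, with
  the summands \<open>a \<otimes> b\<close> replaced by values in a commutative monoid.\<close>

primrec split_sum :: "'x list \<Rightarrow> ('x list \<Rightarrow> 'x list \<Rightarrow> 'm::comm_monoid_add) \<Rightarrow> 'm" where
  "split_sum [] f = f [] []"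
| "split_sum (x # w) f = split_sum w (\<lambda>a b. f a (x # b)) + split_sum w (\<lambda>a b. f (x # a) b)"

text \<open>Parametricity of the splitting sum. With suitable relations it yields congruence,
  compatibility with additive maps (also those that are additive only on a subset, as maps
  between carriers are) and closure properties.\<close>

lemma split_sum_rel:
  assumes "w \<in> lists A"
    and "\<And>x x' y y'. R x y \<Longrightarrow> R x' y' \<Longrightarrow> R (x + x') (y + y')"
    and "\<And>a b. a \<in> lists A \<Longrightarrow> b \<in> lists A \<Longrightarrow> R (f a b) (g a b)"
  shows "R (split_sum w f) (split_sum w g)"
  using assms(1,3) by (induction w arbitrary: f g) (auto intro!: assms(2))

lemma split_sum_closed:
  assumes "w \<in> lists A"
    and "\<And>x y. P x \<Longrightarrow> P y \<Longrightarrow> P (x + y)"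
    and "\<And>a b. a \<in> lists A \<Longrightarrow> b \<in> lists A \<Longrightarrow> P (f a b)"
  shows "P (split_sum w f)"
  by (rule split_sum_rel[where R = "\<lambda>x _. P x" and g = f, OF assms(1)]) (simp_all add: assms(2,3))

lemma split_sum_add: "split_sum w (\<lambda>a b. f a b + g a b) = split_sum w f + split_sum w g"
  by (induction w arbitrary: f g) (simp_all add: add_ac)

lemma split_sum_swap:
  "split_sum v (\<lambda>a b. split_sum w (\<lambda>c d. f a b c d)) =
    split_sum w (\<lambda>c d. split_sum v (\<lambda>a b. f a b c d))"
  by (induction v arbitrary: f) (simp_all add: split_sum_add)

text \<open>Both sides run over all distributions of the letters over three subwords.\<close>

lemma split_sum_coassoc:
  "split_sum w (\<lambda>a b. split_sum b (f a)) = split_sum w (\<lambda>b c. split_sum b (\<lambda>a b. f a b c))"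
  by (induction w arbitrary: f) (simp_all add: split_sum_add add_ac)

lemma split_sum_cocomm: "split_sum w f = split_sum w (\<lambda>a b. f b a)"
proof (induction w arbitrary: f)
  case (Cons x w)
  show ?case
    using Cons.IH[of "\<lambda>a b. f a (x # b)"] Cons.IH[of "\<lambda>a b. f (x # a) b"]
    by (simp add: add.commute)
qed simp

lemma split_sum_append:
  "split_sum (v @ w) f = split_sum v (\<lambda>a b. split_sum w (\<lambda>c d. f (a @ c) (b @ d)))"
  by (induction v arbitrary: f) simp_all

text \<open>Only the splitting with empty first part contributes.\<close>

lemma split_sum_counit:
  assumes "\<And>a b. a \<noteq> [] \<Longrightarrow> f a b = 0"
  shows "split_sum w f = f [] w"
proof -
  have z: "split_sum w (\<lambda>a b. 0) = 0" for w :: "'a list" by (induction w) simp_all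
  show ?thesis using assms
    by (induction w arbitrary: f) (simp_all add: z)
qed

definition pair_append :: "'x list \<times> 'y list \<Rightarrow> 'x list \<times> 'y list \<Rightarrow> 'x list \<times> 'y list"
    (infixr "\<diamondop>" 65) where
  "p \<diamondop> q = (fst p @ fst q, snd p @ snd q)"

text \<open>The analogue for \<open>u \<otimes> v\<close>, whose co-multiplication splits \<open>u\<close> and \<open>v\<close> independently.\<close>

definition pair_split_sum ::
  "'x list \<times> 'y list \<Rightarrow> ('x list \<times> 'y list \<Rightarrow> 'x list \<times> 'y list \<Rightarrow> 'm::comm_monoid_add) \<Rightarrow> 'm" where
  "pair_split_sum p f =
    split_sum (fst p) (\<lambda>u1 u2. split_sum (snd p) (\<lambda>v1 v2. f (u1, v1) (u2, v2)))"

lemma pair_append_closed: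
  "p \<in> lists A \<times> lists B \<Longrightarrow> q \<in> lists A \<times> lists B \<Longrightarrow> p \<diamondop> q \<in> lists A \<times> lists B"
  by (auto simp: pair_append_def)

lemma pair_append_assoc: "(p \<diamondop> q) \<diamondop> r = p \<diamondop> q \<diamondop> r"
  by (simp add: pair_append_def)

lemma pair_append_empty [simp]: "([], []) \<diamondop> p = p" "p \<diamondop> ([], []) = p"
  by (simp_all add: pair_append_def)

lemma pair_split_sum_rel:
  assumes "p \<in> lists A \<times> lists B"
    and R: "\<And>x x' y y'. R x y \<Longrightarrow> R x' y' \<Longrightarrow> R (x + x') (y + y')"
    and "\<And>a b. a \<in> lists A \<times> lists B \<Longrightarrow> b \<in> lists A \<times> lists B \<Longrightarrow> R (f a b) (g a b)"
  shows "R (pair_split_sum p f) (pair_split_sum p g)"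
  unfolding pair_split_sum_def
proof (rule split_sum_rel[where R = R, OF _ R])
  show "R (split_sum (snd p) (\<lambda>v1 v2. f (u1, v1) (u2, v2)))
      (split_sum (snd p) (\<lambda>v1 v2. g (u1, v1) (u2, v2)))"
    if "u1 \<in> lists A" "u2 \<in> lists A" for u1 u2
    using that assms(1) by (intro split_sum_rel[where R = R, OF _ R] assms(3)) auto
qed (use assms(1) in auto)

lemma pair_split_sum_closed:
  assumes "p \<in> lists A \<times> lists B"
    and "\<And>x y. P x \<Longrightarrow> P y \<Longrightarrow> P (x + y)"
    and "\<And>a b. a \<in> lists A \<times> lists B \<Longrightarrow> b \<in> lists A \<times> lists B \<Longrightarrow> P (f a b)"
  shows "P (pair_split_sum p f)"
  by (rule pair_split_sum_rel[where R = "\<lambda>x _. P x" and g = f, OF assms(1)])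
    (simp_all add: assms(2,3))

lemma pair_split_sum_cong:
  assumes "p \<in> lists A \<times> lists B"
    and "\<And>a b. a \<in> lists A \<times> lists B \<Longrightarrow> b \<in> lists A \<times> lists B \<Longrightarrow> f a b = g a b"
  shows "pair_split_sum p f = pair_split_sum p g"
  by (rule pair_split_sum_rel[where R = "(=)", OF assms(1)]) (simp_all add: assms(2))

lemma pair_split_sum_hom:
  assumes "\<And>x y. \<phi> (x + y) = \<phi> x + \<phi> y"
  shows "\<phi> (pair_split_sum p f) = pair_split_sum p (\<lambda>a b. \<phi> (f a b))"
  by (rule pair_split_sum_rel[where R = "\<lambda>x y. \<phi> x = y" and A = UNIV and B = UNIV])
    (simp_all add: assms lists_UNIV mem_Times_iff)

lemma pair_split_sum_swap:
  "pair_split_sum p (\<lambda>a b. pair_split_sum q (\<lambda>c d. f a b c d)) =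
    pair_split_sum q (\<lambda>c d. pair_split_sum p (\<lambda>a b. f a b c d))"
  unfolding pair_split_sum_def
  by (subst split_sum_swap[of "snd p"], subst split_sum_swap[of "fst p"],
      subst split_sum_swap[of "snd p"], subst split_sum_swap[of "fst p"]) (rule refl)

lemma pair_split_sum_swap3:
  "pair_split_sum p (\<lambda>a b. pair_split_sum q (\<lambda>c d. pair_split_sum r (f a b c d))) =
    pair_split_sum r (\<lambda>x y. pair_split_sum p (\<lambda>a b. pair_split_sum q (\<lambda>c d. f a b c d x y)))"
  by (subst pair_split_sum_swap[of q r], subst pair_split_sum_swap[of p r]) (rule refl)

lemma pair_split_sum_coassoc:
  "pair_split_sum p (\<lambda>a b. pair_split_sum b (f a)) =
    pair_split_sum p (\<lambda>b c. pair_split_sum b (\<lambda>a b. f a b c))"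
proof -
  have "pair_split_sum p (\<lambda>a b. pair_split_sum b (f a)) =
      split_sum (fst p) (\<lambda>u1 u'. split_sum u' (\<lambda>u2 u3.
        split_sum (snd p) (\<lambda>v1 v'. split_sum v' (\<lambda>v2 v3. f (u1, v1) (u2, v2) (u3, v3)))))"
    by (simp add: pair_split_sum_def split_sum_swap[of "snd p"])
  also have "\<dots> = split_sum (fst p) (\<lambda>u' u3. split_sum u' (\<lambda>u1 u2.
        split_sum (snd p) (\<lambda>v' v3. split_sum v' (\<lambda>v1 v2. f (u1, v1) (u2, v2) (u3, v3)))))"
    by (simp only: split_sum_coassoc)
  also have "\<dots> = pair_split_sum p (\<lambda>b c. pair_split_sum b (\<lambda>a b. f a b c))"
    by (simp add: pair_split_sum_def split_sum_swap[of "snd p"])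
  finally show ?thesis .
qed

lemma pair_split_sum_cocomm: "pair_split_sum p f = pair_split_sum p (\<lambda>a b. f b a)"
  unfolding pair_split_sum_def
  by (subst split_sum_cocomm, subst (2) split_sum_cocomm) (rule refl)

lemma pair_split_sum_append:
  "pair_split_sum (p \<diamondop> q) f =
    pair_split_sum p (\<lambda>a b. pair_split_sum q (\<lambda>c d. f (a \<diamondop> c) (b \<diamondop> d)))"
  by (simp add: pair_split_sum_def pair_append_def split_sum_append split_sum_swap[of "fst q" "snd p"])

lemma pair_split_sum_counit:
  assumes "\<And>a b. a \<noteq> ([], []) \<Longrightarrow> f a b = 0"
  shows "pair_split_sum p f = f ([], []) p"
proof -
  have z: "split_sum w (\<lambda>a b. 0) = 0" for w :: "'c list" by (induction w) simp_all
  show ?thesis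
    unfolding pair_split_sum_def using assms
    by (subst split_sum_counit) (simp_all add: z split_sum_counit)
qed

text \<open>In a threefold splitting the first two parts may be exchanged; splitting the first part
  further, by coassociativity, reduces this to cocommutativity.\<close>

lemma pair_split_sum_cocomm3:
  "pair_split_sum p (\<lambda>a b. pair_split_sum b (f a)) =
    pair_split_sum p (\<lambda>a b. pair_split_sum b (\<lambda>c d. f c a d))"
  unfolding pair_split_sum_coassoc
  by (subst (2) pair_split_sum_cocomm) (rule refl)

section \<open>The co-multiplication on words\<close>

text \<open>Nested Sweedler sums over the co-multiplications of two elements have summands that depend
  linearly on each of the four parts.\<close>

definition quadrilin_map where
  "quadrilin_map A B C D M g \<longleftrightarrow>
    (\<forall>b\<in>carrier B. \<forall>c\<in>carrier C. \<forall>d\<in>carrier D. lin_map A M (\<lambda>a. g a b c d)) \<and>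
    (\<forall>a\<in>carrier A. \<forall>c\<in>carrier C. \<forall>d\<in>carrier D. lin_map B M (\<lambda>b. g a b c d)) \<and>
    (\<forall>a\<in>carrier A. \<forall>b\<in>carrier B. \<forall>d\<in>carrier D. lin_map C M (\<lambda>c. g a b c d)) \<and>
    (\<forall>a\<in>carrier A. \<forall>b\<in>carrier B. \<forall>c\<in>carrier C. lin_map D M (\<lambda>d. g a b c d))"

lemma nested_sweedler_bilin:
  assumes AB: "module_pair A B" and CD: "module_pair C D" and M: "module ground_field M"
    and g: "quadrilin_map A B C D M g"
  shows "E \<in> carrier (tensor_product C D) \<Longrightarrow> bilin_map A B M (\<lambda>a b. sweedler M (g a b) E)"
    and "bilin_map (tensor_product A B) (tensor_product C D) M
      (\<lambda>D E. sweedler M (\<lambda>a b. sweedler M (g a b) E) D)"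
proof -
  interpret AB: module_pair A B by fact
  interpret CD: module_pair C D by fact
  have 1: "bilin_map C D M (g a b)" if "a \<in> carrier A" "b \<in> carrier B" for a b
    using g that by (intro bilin_mapI) (simp_all add: quadrilin_map_def)
  show 2: "bilin_map A B M (\<lambda>a b. sweedler M (g a b) E)" if E: "E \<in> carrier (tensor_product C D)" for E
  proof (rule bilin_mapI)
    show "lin_map B M (\<lambda>b. sweedler M (g a b) E)" if "a \<in> carrier A" for a
      using g 1 that
      by (intro CD.sweedler_parameter M E AB.B.module_axioms) (simp_all add: quadrilin_map_def)
    show "lin_map A M (\<lambda>a. sweedler M (g a b) E)" if "b \<in> carrier B" for b
      using g 1 that
      by (intro CD.sweedler_parameter M E AB.A.module_axioms) (simp_all add: quadrilin_map_def)
  qed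
  show "bilin_map (tensor_product A B) (tensor_product C D) M
      (\<lambda>D E. sweedler M (\<lambda>a b. sweedler M (g a b) E) D)"
  proof (rule bilin_mapI)
    show "lin_map (tensor_product C D) M (\<lambda>E. sweedler M (\<lambda>a b. sweedler M (g a b) E) X)"
      if "X \<in> carrier (tensor_product A B)" for X
      by (rule AB.sweedler_parameter[OF M CD.module_tensor_product 2 CD.sweedler_lin_map[OF M 1] that])
    show "lin_map (tensor_product A B) M (\<lambda>X. sweedler M (\<lambda>a b. sweedler M (g a b) E) X)"
      if "E \<in> carrier (tensor_product C D)" for E
      by (rule AB.sweedler_lin_map[OF M 2[OF that]])
  qed
qed

text \<open>Evaluation of a Sweedler sum on a tensor given as a splitting sum. The additive map \<open>\<psi>\<close>
  transports sums from a commutative monoid, where splitting sums live, into the module \<open>M\<close>: it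
  will be the identity for scalars, a coset map for tensors and \<open>joint_comb\<close> for elements of the
  joint tensor algebra.\<close>

lemma (in module_pair) sweedler_pair_split_sum:
  assumes M: "module ground_field M" and f: "bilin_map A B M f" and w: "w \<in> lists X \<times> lists Y"
    and \<psi>: "\<And>x y. \<psi> (x + y) = \<psi> x \<oplus>\<^bsub>M\<^esub> \<psi> y"
    and s: "\<And>a. a \<in> lists X \<times> lists Y \<Longrightarrow> s a \<in> carrier A"
      "\<And>b. b \<in> lists X \<times> lists Y \<Longrightarrow> t b \<in> carrier B"
    and h: "\<And>a b. a \<in> lists X \<times> lists Y \<Longrightarrow> b \<in> lists X \<times> lists Y \<Longrightarrow> f (s a) (t b) = \<psi> (h a b)"
  shows "sweedler M f (coset (bilinear_relators A B)
      (pair_split_sum w (\<lambda>a b. Poly_Mapping.single (s a, t b) 1))) = \<psi> (pair_split_sum w h)"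
proof -
  interpret F: factoring_evaluation "carrier A \<times> carrier B" "bilinear_relators A B" M "\<lambda>(a, b). f a b"
    by (rule factoring_bilin[OF M f])
  let ?R = "\<lambda>p x. Poly_Mapping.keys p \<subseteq> carrier A \<times> carrier B \<and> eval_comb M (\<lambda>(a, b). f a b) p = \<psi> x"
  have "?R (pair_split_sum w (\<lambda>a b. Poly_Mapping.single (s a, t b) 1)) (pair_split_sum w h)"
  proof (rule pair_split_sum_rel[where R = ?R, OF w])
    show "?R (p + q) (x + y)" if "?R p x" "?R q y" for p q x y
      using that by (simp add: keys_add_subset F.eval_add \<psi>)
    show "?R (Poly_Mapping.single (s a, t b) 1) (h a b)"
      if "a \<in> lists X \<times> lists Y" "b \<in> lists X \<times> lists Y" for a b
      using s(1)[OF that(1)] s(2)[OF that(2)] h[OF that] F.smult_one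
        bilin_mapD(3)[OF f s(1)[OF that(1)] s(2)[OF that(2)]]
      by (simp add: F.eval_single)
  qed
  then show ?thesis by (simp add: sweedler_def F.lin_ext_coset)
qed

text \<open>Splittings of a single word are splittings of pairs whose second word is empty.\<close>

lemma (in module_pair) sweedler_split_sum:
  assumes M: "module ground_field M" and f: "bilin_map A B M f" and w: "w \<in> lists X"
    and \<psi>: "\<And>x y. \<psi> (x + y) = \<psi> x \<oplus>\<^bsub>M\<^esub> \<psi> y"
    and s: "\<And>a. a \<in> lists X \<Longrightarrow> s a \<in> carrier A" "\<And>b. b \<in> lists X \<Longrightarrow> t b \<in> carrier B"
    and h: "\<And>a b. a \<in> lists X \<Longrightarrow> b \<in> lists X \<Longrightarrow> f (s a) (t b) = \<psi> (h a b)"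
  shows "sweedler M f (coset (bilinear_relators A B)
      (split_sum w (\<lambda>a b. Poly_Mapping.single (s a, t b) 1))) = \<psi> (split_sum w h)"
proof -
  have w': "(w, [] :: unit list) \<in> lists X \<times> lists {}" using w by simp
  have "sweedler M f (coset (bilinear_relators A B) (pair_split_sum (w, [] :: unit list)
      (\<lambda>p q. Poly_Mapping.single (s (fst p), t (fst q)) 1))) =
    \<psi> (pair_split_sum (w, [] :: unit list) (\<lambda>p q. h (fst p) (fst q)))"
    by (rule sweedler_pair_split_sum[where \<psi> = \<psi> and s = "\<lambda>p. s (fst p)" and t = "\<lambda>p. t (fst p)"
        and h = "\<lambda>p q. h (fst p) (fst q)", OF M f w' \<psi>])
      (simp_all only: mem_Times_iff s h)
  then show ?thesis
    by (simp add: pair_split_sum_def)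
qed

context ground_module
begin

sublocale T: bilinear_algebra "tensor_algebra U"
  by (rule bilinear_tensor_algebra)

sublocale TT: algebra_pair "tensor_algebra U" "tensor_algebra U" ..

abbreviation "T \<equiv> tensor_algebra U"
abbreviation "TT \<equiv> tensor_product T T"

sublocale TT: bilinear_algebra TT
  by (rule TT.bilinear_tensor_product)

definition primitive where
  "primitive x = pure_tensor T T \<one>\<^bsub>T\<^esub> (tensor_inj U x) \<oplus>\<^bsub>TT\<^esub> pure_tensor T T (tensor_inj U x) \<one>\<^bsub>T\<^esub>"

definition coproduct_word where
  "coproduct_word w = foldr (\<lambda>x z. primitive x \<otimes>\<^bsub>TT\<^esub> z) w \<one>\<^bsub>TT\<^esub>"

lemma tensor_coproduct_eq: "tensor_coproduct U = lin_ext TT coproduct_word"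
  by (simp add: tensor_coproduct_def coproduct_word_def[abs_def] primitive_def Let_def)

lemma coproduct_word_Cons: "coproduct_word (x # w) = primitive x \<otimes>\<^bsub>TT\<^esub> coproduct_word w"
  by (simp add: coproduct_word_def)

lemma primitive_lin_map: "lin_map U TT primitive"
  unfolding primitive_def[abs_def]
  by (intro lin_map_add TT.module_tensor_product
      lin_map_comp[OF tensor_inj_lin_map bilin_mapD(1)[OF TT.pure_bilin T.algebra_one_closed]]
      lin_map_comp[OF tensor_inj_lin_map bilin_mapD(2)[OF TT.pure_bilin T.algebra_one_closed]])

lemma coproduct_word_closed: "w \<in> lists (carrier U) \<Longrightarrow> coproduct_word w \<in> carrier TT"
  by (induction w) (auto simp: coproduct_word_Cons coproduct_word_def[of "[]"]
      intro: TT.algebra_one_closed TT.algebra_mult_closed lin_mapD(1)[OF primitive_lin_map])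

lemma coproduct_word_multilinear:
  assumes "v \<in> lists (carrier U)" and w: "w \<in> lists (carrier U)"
  shows "lin_map U TT (\<lambda>x. coproduct_word (v @ [x] @ w))"
  using assms(1)
proof (induction v)
  case Nil
  show ?case
    using lin_map_comp[OF primitive_lin_map
        bilin_mapD(2)[OF TT.mult_bilin coproduct_word_closed[OF w]]]
    by (simp add: coproduct_word_Cons)
next
  case (Cons y v)
  then have y: "primitive y \<in> carrier TT" by (intro lin_mapD(1)[OF primitive_lin_map]) simp
  show ?case
    using lin_map_comp[OF Cons.IH bilin_mapD(1)[OF TT.mult_bilin y]]
    by (simp add: coproduct_word_Cons)
qed

lemma factoring_coproduct_word:
  "factoring_evaluation (lists (carrier U)) (multilinear_relators U) TT coproduct_word"
  by (rule factoring_multilinear[OF TT.module_tensor_product coproduct_word_closed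
        coproduct_word_multilinear])

lemma tensor_coproduct_lin_map: "lin_map T TT (tensor_coproduct U)"
  using factoring_evaluation.lin_ext_lin_map[OF factoring_coproduct_word]
  by (simp add: tensor_coproduct_eq tensor_algebra_def)

text \<open>Expanding the product of the values \<open>1 \<otimes> x + x \<otimes> 1\<close> of the letters: each letter goes
  either to the right or to the left factor.\<close>

lemma tensor_coproduct_word:
  assumes "w \<in> lists (carrier U)"
  shows "tensor_coproduct U (word U w) = coset (bilinear_relators T T)
    (split_sum w (\<lambda>a b. Poly_Mapping.single (word U a, word U b) 1))"
proof -
  let ?s = "\<lambda>a b. Poly_Mapping.single (word U a, word U b) 1"
  let ?m = "\<lambda>(a, b) (a', b'). (a \<otimes>\<^bsub>T\<^esub> a', b \<otimes>\<^bsub>T\<^esub> b')"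
  have "coproduct_word w = coset (bilinear_relators T T) (split_sum w ?s)"
    using assms
  proof (induction w)
    case Nil
    show ?case
      by (simp add: coproduct_word_def TT.tensor_product_one tensor_algebra_one pure_tensor_def)
  next
    case (Cons x w)
    then have x: "[x] \<in> lists (carrier U)" and w: "w \<in> lists (carrier U)" by auto
    let ?p = "?s [] [x] + ?s [x] []"
    have p: "Poly_Mapping.keys ?p \<subseteq> carrier T \<times> carrier T"
      by (intro keys_add_subset keys_single_subset) (simp_all add: word_closed[OF x] word_closed)
    have q: "Poly_Mapping.keys (split_sum w ?s) \<subseteq> carrier T \<times> carrier T"
      by (rule split_sum_closed[OF w]) (simp_all add: keys_add_subset keys_single_subset word_closed)
    have step: "comb_mult ?m ?p (split_sum w ?s) =
        split_sum w (\<lambda>a b. ?s a (x # b) + ?s (x # a) b)"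
    proof (rule split_sum_rel[where R = "\<lambda>r r'. comb_mult ?m ?p r = r'", OF w])
      show "comb_mult ?m ?p (r + s) = r' + s'"
        if "comb_mult ?m ?p r = r'" "comb_mult ?m ?p s = s'" for r s r' s'
        using that by (simp add: comb_mult_add_right)
      show "comb_mult ?m ?p (?s a b) = ?s a (x # b) + ?s (x # a) b"
        if "a \<in> lists (carrier U)" "b \<in> lists (carrier U)" for a b
        using that x by (simp add: comb_mult_add_left comb_mult_single word_mult)
    qed
    have "primitive x = coset (bilinear_relators T T) ?p"
      by (simp add: primitive_def pure_tensor_def tensor_inj_eq_word tensor_algebra_one
          tensor_product_def presented_add)
    then have "coproduct_word (x # w) =
        coset (bilinear_relators T T) (comb_mult ?m ?p (split_sum w ?s))"
      using TT.presented_mult[OF p q] Cons.IH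
      by (simp add: coproduct_word_Cons tensor_product_def)
    then show ?case by (simp add: step split_sum_add)
  qed
  then show ?thesis
    using factoring_evaluation.lin_ext_generator[OF factoring_coproduct_word assms]
    by (simp add: tensor_coproduct_eq word_def)
qed

lemma sweedler_tensor_coproduct:
  assumes "module ground_field M" and "bilin_map T T M f" and "w \<in> lists (carrier U)"
    and "\<And>x y. \<psi> (x + y) = \<psi> x \<oplus>\<^bsub>M\<^esub> \<psi> y"
    and "\<And>a b. a \<in> lists (carrier U) \<Longrightarrow> b \<in> lists (carrier U) \<Longrightarrow> f (word U a) (word U b) = \<psi> (h a b)"
  shows "sweedler M f (tensor_coproduct U (word U w)) = \<psi> (split_sum w h)"
  unfolding tensor_coproduct_word[OF assms(3)]
  by (rule TT.sweedler_split_sum[where \<psi> = \<psi>, OF assms(1-4)]) (simp_all add: word_closed assms(5))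

lemma lin_map_eq_on_words:
  assumes \<phi>: "lin_map T M \<phi>" and \<psi>: "lin_map T M \<psi>" and M: "module ground_field M"
    and eq: "\<And>w. w \<in> lists (carrier U) \<Longrightarrow> \<phi> (word U w) = \<psi> (word U w)"
    and x: "x \<in> carrier T"
  shows "\<phi> x = \<psi> x"
  using x
  by (induction rule: tensor_algebra_induct)
    (simp_all add: lin_map_zero[OF \<phi> T.algebra_module M] lin_map_zero[OF \<psi> T.algebra_module M]
      lin_mapD(2,3)[OF \<phi>] lin_mapD(2,3)[OF \<psi>] word_closed eq)

end

section \<open>The joint tensor algebra\<close>

locale ground_pair = U: ground_module U + V: ground_module V
  for U :: "('k::field, 'u) module" and V :: "('k, 'v) module"
begin

sublocale J: algebra_pair "tensor_algebra U" "tensor_algebra V" ..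

abbreviation "J \<equiv> joint_algebra U V"
abbreviation "JJ \<equiv> tensor_product J J"
abbreviation "W \<equiv> lists (carrier U) \<times> lists (carrier V)"

sublocale J: bilinear_algebra J
  unfolding joint_algebra_def by (rule J.bilinear_tensor_product)

sublocale JJ: algebra_pair J J ..

definition joint_word :: "'u list \<times> 'v list \<Rightarrow> ('k, 'u, 'v) joint" where
  "joint_word w = joint_tensor U V (word U (fst w)) (word V (snd w))"

lemma joint_tensor_bilin: "bilin_map U.T V.T J (joint_tensor U V)"
  using J.pure_bilin by (simp add: joint_algebra_def)

lemma joint_word_closed: "w \<in> W \<Longrightarrow> joint_word w \<in> carrier J"
  by (auto simp: joint_word_def
      intro!: bilin_mapD(3)[OF joint_tensor_bilin] U.word_closed V.word_closed)

lemma joint_one: "\<one>\<^bsub>J\<^esub> = joint_word ([], [])"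
  by (simp add: joint_algebra_def J.tensor_product_one U.tensor_algebra_one V.tensor_algebra_one
      joint_word_def)

lemma joint_word_mult:
  "p \<in> W \<Longrightarrow> q \<in> W \<Longrightarrow> joint_word p \<otimes>\<^bsub>J\<^esub> joint_word q = joint_word (p \<diamondop> q)"
  by (simp add: joint_word_def joint_algebra_def J.pure_mult U.word_closed V.word_closed
      U.word_mult V.word_mult pair_append_def mem_Times_iff del: in_lists_conv_set)

text \<open>The words span: on \<open>a \<otimes> b\<close> the two maps are compared first with \<open>b\<close> a word and \<open>a\<close>
  arbitrary, then with both arbitrary.\<close>

lemma lin_map_eq_on_joint_words:
  assumes \<phi>: "lin_map J M \<phi>" and \<psi>: "lin_map J M \<psi>" and M: "module ground_field M"
    and eq: "\<And>w. w \<in> W \<Longrightarrow> \<phi> (joint_word w) = \<psi> (joint_word w)"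
    and x: "x \<in> carrier J"
  shows "\<phi> x = \<psi> x"
proof -
  have words: "\<phi> (joint_tensor U V (word U u) (word V v)) = \<psi> (joint_tensor U V (word U u) (word V v))"
    if "u \<in> lists (carrier U)" "v \<in> lists (carrier V)" for u v
    using eq[of "(u, v)"] that by (simp add: joint_word_def)
  have left: "\<phi> (joint_tensor U V a (word V v)) = \<psi> (joint_tensor U V a (word V v))"
    if a: "a \<in> carrier U.T" and v: "v \<in> lists (carrier V)" for a v
  proof -
    note lin = lin_map_comp[OF bilin_mapD(2)[OF joint_tensor_bilin V.word_closed[OF v]]]
    show ?thesis
      by (rule U.lin_map_eq_on_words[OF lin[OF \<phi>] lin[OF \<psi>] M _ a]) (rule words[OF _ v])
  qed
  have pure: "\<phi> (joint_tensor U V a b) = \<psi> (joint_tensor U V a b)"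
    if a: "a \<in> carrier U.T" and b: "b \<in> carrier V.T" for a b
  proof -
    note lin = lin_map_comp[OF bilin_mapD(1)[OF joint_tensor_bilin a]]
    show ?thesis
      by (rule V.lin_map_eq_on_words[OF lin[OF \<phi>] lin[OF \<psi>] M _ b]) (rule left[OF a])
  qed
  have pure_smult: "\<phi> (c \<odot>\<^bsub>J\<^esub> joint_tensor U V a b) = \<psi> (c \<odot>\<^bsub>J\<^esub> joint_tensor U V a b)"
    if "a \<in> carrier U.T" and "b \<in> carrier V.T" for a b c
    using pure[OF that] bilin_mapD(3)[OF joint_tensor_bilin that]
    by (simp add: lin_mapD(3)[OF \<phi>] lin_mapD(3)[OF \<psi>])
  show ?thesis
    using x unfolding joint_algebra_def
  proof (induction rule: J.tensor_induct)
    case zero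
    show ?case
      using lin_map_zero[OF \<phi> J.algebra_module M] lin_map_zero[OF \<psi> J.algebra_module M]
      by (simp add: joint_algebra_def)
  next
    case (pure c a b)
    then show ?case by (rule pure_smult[unfolded joint_algebra_def])
  next
    case (add D E)
    then show ?case
      using lin_mapD(2)[OF \<phi>, of D E] lin_mapD(2)[OF \<psi>, of D E] by (simp add: joint_algebra_def)
  qed
qed

definition coproduct_summand where
  "coproduct_summand u1 u2 v1 v2 =
    pure_tensor J J (joint_tensor U V u1 v1) (joint_tensor U V u2 v2)"

lemma quadrilin_coproduct_summand: "quadrilin_map U.T U.T V.T V.T JJ coproduct_summand"
proof -
  note cl = bilin_mapD(3)[OF joint_tensor_bilin]
  note lin1 = bilin_mapD(1)[OF joint_tensor_bilin] and lin2 = bilin_mapD(2)[OF joint_tensor_bilin]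
  note pure1 = bilin_mapD(1)[OF JJ.pure_bilin cl] and pure2 = bilin_mapD(2)[OF JJ.pure_bilin cl]
  show ?thesis
    unfolding quadrilin_map_def coproduct_summand_def
  proof (intro conjI ballI)
    fix u1 u2 v1 v2
    show "lin_map U.T JJ (\<lambda>u1. pure_tensor J J (joint_tensor U V u1 v1) (joint_tensor U V u2 v2))"
      if "u2 \<in> carrier U.T" "v1 \<in> carrier V.T" "v2 \<in> carrier V.T"
      by (rule lin_map_comp[OF lin2[OF that(2)] pure2[OF that(1,3)]])
    show "lin_map U.T JJ (\<lambda>u2. pure_tensor J J (joint_tensor U V u1 v1) (joint_tensor U V u2 v2))"
      if "u1 \<in> carrier U.T" "v1 \<in> carrier V.T" "v2 \<in> carrier V.T"
      by (rule lin_map_comp[OF lin2[OF that(3)] pure1[OF that(1,2)]])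
    show "lin_map V.T JJ (\<lambda>v1. pure_tensor J J (joint_tensor U V u1 v1) (joint_tensor U V u2 v2))"
      if "u1 \<in> carrier U.T" "u2 \<in> carrier U.T" "v2 \<in> carrier V.T"
      by (rule lin_map_comp[OF lin1[OF that(1)] pure2[OF that(2,3)]])
    show "lin_map V.T JJ (\<lambda>v2. pure_tensor J J (joint_tensor U V u1 v1) (joint_tensor U V u2 v2))"
      if "u1 \<in> carrier U.T" "u2 \<in> carrier U.T" "v1 \<in> carrier V.T"
      by (rule lin_map_comp[OF lin1[OF that(2)] pure1[OF that(1,3)]])
  qed
qed

lemma joint_coproduct_eq:
  "joint_coproduct U V = sweedler JJ (\<lambda>u v.
    sweedler JJ (\<lambda>u1 u2. sweedler JJ (coproduct_summand u1 u2) (tensor_coproduct V v))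
      (tensor_coproduct U u))"
  by (simp add: joint_coproduct_def sweedler_def[abs_def] coproduct_summand_def[abs_def] Let_def)

lemmas nested_coproduct = nested_sweedler_bilin[OF U.TT.module_pair_axioms V.TT.module_pair_axioms
  JJ.module_tensor_product quadrilin_coproduct_summand]

lemma coproduct_bilin:
  "bilin_map U.T V.T JJ (\<lambda>u v.
    sweedler JJ (\<lambda>u1 u2. sweedler JJ (coproduct_summand u1 u2) (tensor_coproduct V v))
      (tensor_coproduct U u))"
proof (rule bilin_mapI)
  note D = U.tensor_coproduct_lin_map and E = V.tensor_coproduct_lin_map
  show "lin_map V.T JJ (\<lambda>v.
      sweedler JJ (\<lambda>u1 u2. sweedler JJ (coproduct_summand u1 u2) (tensor_coproduct V v))
        (tensor_coproduct U u))" if "u \<in> carrier U.T" for u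
    by (rule lin_map_comp[OF E bilin_mapD(1)[OF nested_coproduct(2) lin_mapD(1)[OF D that]]])
  show "lin_map U.T JJ (\<lambda>u.
      sweedler JJ (\<lambda>u1 u2. sweedler JJ (coproduct_summand u1 u2) (tensor_coproduct V v))
        (tensor_coproduct U u))" if "v \<in> carrier V.T" for v
    by (rule lin_map_comp[OF D bilin_mapD(2)[OF nested_coproduct(2) lin_mapD(1)[OF E that]]])
qed

lemma joint_coproduct_lin_map: "lin_map J JJ (joint_coproduct U V)"
  using J.sweedler_lin_map[OF JJ.module_tensor_product coproduct_bilin]
  by (simp add: joint_coproduct_eq joint_algebra_def)

lemma joint_coproduct_word:
  assumes w: "w \<in> W"
  shows "joint_coproduct U V (joint_word w) = coset (bilinear_relators J J)
    (pair_split_sum w (\<lambda>a b. Poly_Mapping.single (joint_word a, joint_word b) 1))"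
proof -
  obtain u v where uv: "w = (u, v)" "u \<in> lists (carrier U)" "v \<in> lists (carrier V)"
    using w by auto
  let ?s = "\<lambda>u1 u2 v1 v2. Poly_Mapping.single (joint_word (u1, v1), joint_word (u2, v2)) 1"
  let ?c = "coset (bilinear_relators J J)"
  have add: "?c (x + y) = ?c x \<oplus>\<^bsub>JJ\<^esub> ?c y" for x y
    by (simp add: tensor_product_def presented_add)
  have q: "bilin_map V.T V.T JJ (coproduct_summand u1 u2)"
    if "u1 \<in> carrier U.T" "u2 \<in> carrier U.T" for u1 u2
    using quadrilin_coproduct_summand that by (intro bilin_mapI) (simp_all add: quadrilin_map_def)
  have inner: "sweedler JJ (coproduct_summand (word U u1) (word U u2)) (tensor_coproduct V (word V v))
      = ?c (split_sum v (?s u1 u2))"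
    if "u1 \<in> lists (carrier U)" "u2 \<in> lists (carrier U)" for u1 u2
    by (rule V.sweedler_tensor_coproduct[where \<psi> = ?c, OF JJ.module_tensor_product
          q[OF U.word_closed[OF that(1)] U.word_closed[OF that(2)]] uv(3) add])
      (simp add: coproduct_summand_def joint_word_def pure_tensor_def[of J J])
  have vD: "tensor_coproduct V (word V v) \<in> carrier V.TT"
    by (rule lin_mapD(1)[OF V.tensor_coproduct_lin_map V.word_closed[OF uv(3)]])
  have "joint_coproduct U V (joint_word w) =
      sweedler JJ (\<lambda>u1 u2. sweedler JJ (coproduct_summand u1 u2) (tensor_coproduct V (word V v)))
        (tensor_coproduct U (word U u))"
    using J.sweedler_pure[OF JJ.module_tensor_product coproduct_bilin
        U.word_closed[OF uv(2)] V.word_closed[OF uv(3)]]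
    by (simp add: joint_coproduct_eq joint_word_def uv(1))
  also have "\<dots> = ?c (split_sum u (\<lambda>u1 u2. split_sum v (?s u1 u2)))"
    by (rule U.sweedler_tensor_coproduct[where \<psi> = ?c, OF JJ.module_tensor_product
          nested_coproduct(1)[OF vD] uv(2) add inner])
  finally show ?thesis by (simp add: pair_split_sum_def uv(1))
qed

lemma sweedler_joint_coproduct:
  assumes "module ground_field M" and "bilin_map J J M f" and "w \<in> W"
    and "\<And>x y. \<psi> (x + y) = \<psi> x \<oplus>\<^bsub>M\<^esub> \<psi> y"
    and "\<And>a b. a \<in> W \<Longrightarrow> b \<in> W \<Longrightarrow> f (joint_word a) (joint_word b) = \<psi> (h a b)"
  shows "sweedler M f (joint_coproduct U V (joint_word w)) = \<psi> (pair_split_sum w h)"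
  unfolding joint_coproduct_word[OF assms(3)]
  by (rule JJ.sweedler_pair_split_sum[where \<psi> = \<psi>, OF assms(1-4)])
    (simp_all only: joint_word_closed assms(5))

text \<open>The linear map from the free vector space on pairs of words onto the joint tensor algebra.
  It is defined by relabelling generators, not as a sum in the module, so that it is additive
  without any condition on supports.\<close>

definition joint_comb :: "('u list \<times> 'v list \<Rightarrow>\<^sub>0 'k) \<Rightarrow> ('k, 'u, 'v) joint" where
  "joint_comb p = coset (bilinear_relators (tensor_algebra U) (tensor_algebra V))
    (\<Sum>w\<in>Poly_Mapping.keys p.
      Poly_Mapping.single (word U (fst w), word V (snd w)) (Poly_Mapping.lookup p w))"

lemma joint_comb_add: "joint_comb (p + q) = joint_comb p \<oplus>\<^bsub>J\<^esub> joint_comb q"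
  unfolding joint_comb_def
  by (subst sum_keys_add[where F = "\<lambda>w. Poly_Mapping.single (word U (fst w), word V (snd w))"])
    (simp_all add: single_add joint_algebra_def tensor_product_def presented_add)

lemma joint_comb_single: "joint_comb (Poly_Mapping.single w c) = c \<odot>\<^bsub>J\<^esub> joint_word w"
  by (simp add: joint_comb_def joint_algebra_def tensor_product_def joint_word_def
      pure_tensor_def presented_smult)

lemma joint_comb_zero: "joint_comb 0 = \<zero>\<^bsub>J\<^esub>"
  by (simp add: joint_comb_def joint_algebra_def tensor_product_def presented_zero)

lemma joint_comb_closed: "Poly_Mapping.keys p \<subseteq> W \<Longrightarrow> joint_comb p \<in> carrier J"
  by (induction p rule: poly_mapping_additive_induct)
    (simp_all only: joint_comb_add joint_comb_single joint_comb_zero J.smult_closed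
      J.zero_closed J.add.m_closed joint_word_closed ground_field_simps UNIV_I)

lemma joint_comb_scale:
  "Poly_Mapping.keys p \<subseteq> W \<Longrightarrow> joint_comb (scale_comb c p) = c \<odot>\<^bsub>J\<^esub> joint_comb p"
proof (induction p rule: poly_mapping_additive_induct)
  case zero
  then show ?case using J.smult_r_null[of c] by (simp add: joint_comb_zero)
next
  case (single g b)
  show ?case
    using J.smult_assoc1[of c b "joint_word g"] joint_word_closed[OF single]
    by (simp add: joint_comb_single)
next
  case (add p q)
  then show ?case
    using J.smult_r_distr[of c "joint_comb p" "joint_comb q"]
    by (simp add: scale_comb_add joint_comb_add joint_comb_closed)
qed

lemma joint_comb_word: "w \<in> W \<Longrightarrow> joint_comb (Poly_Mapping.single w 1) = joint_word w"
  using J.smult_one[OF joint_word_closed] by (simp add: joint_comb_single)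

end

section \<open>The square product\<close>

locale laplace = ground_pair U V
  for U :: "('k::field, 'u) module" and V :: "('k, 'v) module" +
  fixes d :: "'u \<Rightarrow> 'v \<Rightarrow> 'k" and L :: "('k, 'u, 'v) joint \<Rightarrow> ('k, 'u, 'v) joint \<Rightarrow> 'k"
  assumes pairing: "laplace_pairing U V L"
    and compatible: "compatible_with_duality U V d L"
begin

definition word_pairing where
  "word_pairing p q = L (joint_word p) (joint_word q)"

lemma L_bilin: "bilin_map J J ground_field L"
  using pairing unfolding laplace_pairing_def bilinear_form_def Let_def
  by (intro bilin_mapI lin_mapI) simp_all

lemma word_pairing_sym: "p \<in> W \<Longrightarrow> q \<in> W \<Longrightarrow> word_pairing p q = word_pairing q p"
  using pairing by (simp add: laplace_pairing_def Let_def word_pairing_def joint_word_closed)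

lemma word_pairing_append_right:
  assumes w: "w \<in> W" and p: "p \<in> W" and q: "q \<in> W"
  shows "word_pairing w (p \<diamondop> q) =
    pair_split_sum w (\<lambda>a b. word_pairing a p * word_pairing b q)"
proof -
  let ?f = "\<lambda>x y. L x (joint_word p) * L y (joint_word q)"
  have "bilin_map J J ground_field ?f"
  proof (rule bilin_mapI)
    show "lin_map J ground_field (?f x)" if "x \<in> carrier J" for x
      using lin_map_smult[OF bilin_mapD(2)[OF L_bilin joint_word_closed[OF q]] module_ground_field]
      by simp
    show "lin_map J ground_field (\<lambda>x. ?f x y)" if "y \<in> carrier J" for y
      using lin_map_smult[OF bilin_mapD(2)[OF L_bilin joint_word_closed[OF p]] module_ground_field,
          of "L y (joint_word q)"]
      by (simp add: mult.commute)
  qed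
  then have "sweedler ground_field ?f (joint_coproduct U V (joint_word w)) =
      pair_split_sum w (\<lambda>a b. word_pairing a p * word_pairing b q)"
    by (intro sweedler_joint_coproduct[where \<psi> = "\<lambda>x. x"] module_ground_field w)
      (simp_all add: word_pairing_def)
  moreover have "L (joint_word w) (joint_word p \<otimes>\<^bsub>J\<^esub> joint_word q) =
      sweedler ground_field ?f (joint_coproduct U V (joint_word w))"
    using pairing joint_word_closed[OF w] joint_word_closed[OF p] joint_word_closed[OF q]
    by (simp add: laplace_pairing_def Let_def)
  ultimately show ?thesis
    by (simp only: word_pairing_def joint_word_mult[OF p q])
qed

text \<open>The mirror image of the Laplace identity, by symmetry of the pairing.\<close>

lemma word_pairing_append_left:
  assumes w: "w \<in> W" and p: "p \<in> W" and q: "q \<in> W"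
  shows "word_pairing (p \<diamondop> q) w =
    pair_split_sum w (\<lambda>a b. word_pairing p a * word_pairing q b)"
proof -
  have "word_pairing (p \<diamondop> q) w = word_pairing w (p \<diamondop> q)"
    by (rule word_pairing_sym[OF pair_append_closed[OF p q] w])
  then show ?thesis
    unfolding word_pairing_append_right[OF assms]
    using pair_split_sum_cong[OF w, of "\<lambda>a b. word_pairing a p * word_pairing b q"
        "\<lambda>a b. word_pairing p a * word_pairing q b"] word_pairing_sym p q by simp
qed

text \<open>Pairing with the unit is the counit: since the unit is group-like, the pairing with it is
  multiplicative, and it vanishes on words of length one.\<close>

lemma word_pairing_unit:
  assumes "w \<in> W"
  shows "word_pairing ([], []) w = (if w = ([], []) then 1 else 0)"
proof -
  have unit_closed: "([], []) \<in> W" by simp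
  have gen: "word_pairing ([], []) ([x], []) = 0" if "x \<in> carrier U" for x
    using compatible that
    by (simp add: compatible_with_duality_def Let_def word_pairing_def joint_one joint_word_def
        U.tensor_inj_eq_word V.tensor_algebra_one)
  have gen': "word_pairing ([], []) ([], [y]) = 0" if "y \<in> carrier V" for y
    using compatible that
    by (simp add: compatible_with_duality_def Let_def word_pairing_def joint_one joint_word_def
        V.tensor_inj_eq_word U.tensor_algebra_one)
  have one: "word_pairing ([], []) ([], []) = 1"
    using compatible
    by (simp add: compatible_with_duality_def Let_def word_pairing_def joint_one)
  have mult: "word_pairing ([], []) (p \<diamondop> q) = word_pairing ([], []) p * word_pairing ([], []) q"
    if "p \<in> W" "q \<in> W" for p q
    using word_pairing_append_right[OF unit_closed that] by (simp add: pair_split_sum_def)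
  obtain u v where w: "w = (u, v)" "u \<in> lists (carrier U)" "v \<in> lists (carrier V)"
    using assms by auto
  show ?thesis
  proof (cases u)
    case (Cons x u')
    then show ?thesis
      using mult[of "([x], [])" "(u', v)"] gen[of x] w by (simp add: pair_append_def)
  next
    case Nil
    show ?thesis
    proof (cases v)
      case (Cons y v')
      then show ?thesis
        using mult[of "([], [y])" "([], v')"] gen'[of y] w Nil by (simp add: pair_append_def)
    qed (simp add: Nil w one)
  qed
qed

definition square_summand where
  "square_summand a1 a2 b1 b2 = L a1 b1 \<odot>\<^bsub>J\<^esub> (a2 \<otimes>\<^bsub>J\<^esub> b2)"

lemma quadrilin_square_summand: "quadrilin_map J J J J J square_summand"
  unfolding quadrilin_map_def square_summand_def
  by (intro conjI ballI lin_map_smult lin_map_smult_left J.algebra_module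
      bilin_mapD(1,2)[OF L_bilin] bilin_mapD(1,2)[OF J.mult_bilin] J.algebra_mult_closed)

lemmas nested_square = nested_sweedler_bilin[OF JJ.module_pair_axioms JJ.module_pair_axioms
  J.algebra_module quadrilin_square_summand]

abbreviation square (infixl "\<box>" 70) where
  "a \<box> b \<equiv> square_product U V L a b"

lemma square_eq:
  "a \<box> b = sweedler J (\<lambda>a1 a2. sweedler J (square_summand a1 a2) (joint_coproduct U V b))
    (joint_coproduct U V a)"
  by (simp add: square_product_def square_summand_def[abs_def] Let_def)

lemma square_bilin: "bilin_map J J J (\<lambda>a b. a \<box> b)"
proof (rule bilin_mapI)
  note D = joint_coproduct_lin_map
  show "lin_map J J (\<lambda>b. a \<box> b)" if "a \<in> carrier J" for a
    unfolding square_eq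
    by (rule lin_map_comp[OF D bilin_mapD(1)[OF nested_square(2) lin_mapD(1)[OF D that]]])
  show "lin_map J J (\<lambda>a. a \<box> b)" if "b \<in> carrier J" for b
    unfolding square_eq
    by (rule lin_map_comp[OF D bilin_mapD(2)[OF nested_square(2) lin_mapD(1)[OF D that]]])
qed

text \<open>The square product of two words before the relations are imposed; \<open>word_pairing\<close> enters as
  the coefficient of a formal combination.\<close>

definition word_square where
  "word_square p q = pair_split_sum p (\<lambda>a1 a2. pair_split_sum q (\<lambda>b1 b2.
    Poly_Mapping.single (a2 \<diamondop> b2) (word_pairing a1 b1)))"

lemma square_words:
  assumes p: "p \<in> W" and q: "q \<in> W"
  shows "joint_word p \<box> joint_word q = joint_comb (word_square p q)"
proof -
  have s: "square_summand (joint_word a1) (joint_word a2) (joint_word b1) (joint_word b2) =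
      joint_comb (Poly_Mapping.single (a2 \<diamondop> b2) (word_pairing a1 b1))"
    if "a2 \<in> W" "b2 \<in> W" for a1 a2 b1 b2
    by (simp only: square_summand_def joint_comb_single joint_word_mult[OF that] word_pairing_def)
  have bl: "bilin_map J J J (square_summand x y)" if "x \<in> carrier J" "y \<in> carrier J" for x y
    using quadrilin_square_summand that by (intro bilin_mapI) (simp_all add: quadrilin_map_def)
  have qD: "joint_coproduct U V (joint_word q) \<in> carrier JJ"
    by (rule lin_mapD(1)[OF joint_coproduct_lin_map joint_word_closed[OF q]])
  have inner: "sweedler J (square_summand (joint_word a1) (joint_word a2))
        (joint_coproduct U V (joint_word q)) =
      joint_comb (pair_split_sum q (\<lambda>b1 b2. Poly_Mapping.single (a2 \<diamondop> b2) (word_pairing a1 b1)))"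
    if "a1 \<in> W" "a2 \<in> W" for a1 a2
    by (rule sweedler_joint_coproduct[where \<psi> = joint_comb, OF J.algebra_module
          bl[OF joint_word_closed[OF that(1)] joint_word_closed[OF that(2)]] q joint_comb_add
          s[OF that(2)]])
  show ?thesis
    unfolding square_eq word_square_def
    by (rule sweedler_joint_coproduct[where \<psi> = joint_comb, OF J.algebra_module
          nested_square(1)[OF qD] p joint_comb_add inner])
qed

lemma keys_word_square:
  assumes p: "p \<in> W" and q: "q \<in> W"
  shows "Poly_Mapping.keys (word_square p q) \<subseteq> W"
  unfolding word_square_def
  by (intro pair_split_sum_closed[where P = "\<lambda>r. Poly_Mapping.keys r \<subseteq> W", OF p]
      pair_split_sum_closed[where P = "\<lambda>r. Poly_Mapping.keys r \<subseteq> W", OF q]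
      keys_add_subset keys_single_subset pair_append_closed)

text \<open>This lets a second square product act on the result of a first one: multiplication by a
  word is a linear map \<open>\<phi>\<close> whose values on words are again images of formal combinations.\<close>

lemma lin_map_joint_comb_word_square:
  assumes \<phi>: "lin_map J J \<phi>" and p: "p \<in> W" and q: "q \<in> W"
    and h: "\<And>w. w \<in> W \<Longrightarrow> \<phi> (joint_word w) = joint_comb (h w)"
      "\<And>w. w \<in> W \<Longrightarrow> Poly_Mapping.keys (h w) \<subseteq> W"
  shows "\<phi> (joint_comb (word_square p q)) = joint_comb
    (pair_split_sum p (\<lambda>a1 a2. pair_split_sum q (\<lambda>b1 b2.
      scale_comb (word_pairing a1 b1) (h (a2 \<diamondop> b2)))))"
proof -
  let ?R = "\<lambda>x y. Poly_Mapping.keys x \<subseteq> W \<and> \<phi> (joint_comb x) = joint_comb y"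
  have add: "?R (x + x') (y + y')" if "?R x y" "?R x' y'" for x x' y y'
    using that by (simp only: keys_add_subset joint_comb_add lin_mapD(2)[OF \<phi>] joint_comb_closed
        simp_thms)
  have "?R (word_square p q) (pair_split_sum p (\<lambda>a1 a2. pair_split_sum q (\<lambda>b1 b2.
      scale_comb (word_pairing a1 b1) (h (a2 \<diamondop> b2)))))"
    unfolding word_square_def
  proof (rule pair_split_sum_rel[where R = ?R, OF p add], assumption, assumption,
      rule pair_split_sum_rel[where R = ?R, OF q add], assumption, assumption)
    fix a1 a2 b1 b2 assume "a2 \<in> W" "b2 \<in> W"
    then have w: "a2 \<diamondop> b2 \<in> W" by (rule pair_append_closed)
    show "?R (Poly_Mapping.single (a2 \<diamondop> b2) (word_pairing a1 b1))
        (scale_comb (word_pairing a1 b1) (h (a2 \<diamondop> b2)))"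
      by (simp only: keys_single_subset[OF w] joint_comb_single
          lin_mapD(3)[OF \<phi> joint_word_closed[OF w]]
          h(1)[OF w] joint_comb_scale[OF h(2)[OF w]] simp_thms)
  qed
  then show ?thesis ..
qed

text \<open>The computation behind the theorem. Both sides are brought to a sum over threefold
  splittings of \<open>p\<close>, \<open>q\<close> and \<open>r\<close> with the same third parts; on the right the first two parts of
  \<open>q\<close> and of \<open>r\<close> occur in exchanged roles.\<close>

lemma word_square_assoc:
  assumes p: "p \<in> W" and q: "q \<in> W" and r: "r \<in> W"
  shows "pair_split_sum p (\<lambda>a1 a2. pair_split_sum q (\<lambda>b1 b2.
      scale_comb (word_pairing a1 b1) (word_square (a2 \<diamondop> b2) r))) =
    pair_split_sum q (\<lambda>b1 b2. pair_split_sum r (\<lambda>c1 c2.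
      scale_comb (word_pairing b1 c1) (word_square p (b2 \<diamondop> c2))))"
    (is "?lhs = ?rhs")
proof -
  \<comment> \<open>The common summand of both sides, up to the exchange of parts.\<close>
  let ?S = "\<lambda>a1 a2 a3 b1 b2 b3 c1 c2 c3. Poly_Mapping.single (a3 \<diamondop> b3 \<diamondop> c3)
      (word_pairing a1 b1 * (word_pairing a2 c1 * word_pairing b2 c2))"
  let ?three = "\<lambda>w f. pair_split_sum w (\<lambda>a a'. pair_split_sum a' (f a))"
  note hom = pair_split_sum_hom[where \<phi> = "scale_comb _", OF scale_comb_add]
  have left: "scale_comb (word_pairing a1 b1) (word_square (a \<diamondop> b) r) =
      pair_split_sum a (\<lambda>a2 a3. pair_split_sum b (\<lambda>b2 b3.
        ?three r (\<lambda>c1 c2 c3. ?S a1 a2 a3 b1 b2 b3 c1 c2 c3)))"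
    if a: "a \<in> W" and b: "b \<in> W" for a1 b1 a b
  proof -
    have single: "Poly_Mapping.single x (l * word_pairing (a2 \<diamondop> b2) c) =
        pair_split_sum c (\<lambda>c1 c2. Poly_Mapping.single x (l * (word_pairing a2 c1 * word_pairing b2 c2)))"
      if "a2 \<in> W" "b2 \<in> W" "c \<in> W" for x l a2 b2 c
      unfolding word_pairing_append_left[OF that(3,1,2)]
      by (rule pair_split_sum_hom[where \<phi> = "\<lambda>y. Poly_Mapping.single x (l * y)"])
        (simp add: distrib_left single_add)
    have "scale_comb (word_pairing a1 b1) (word_square (a \<diamondop> b) r) =
        pair_split_sum a (\<lambda>a2 a3. pair_split_sum b (\<lambda>b2 b3. pair_split_sum r (\<lambda>c c3.
          Poly_Mapping.single (a3 \<diamondop> b3 \<diamondop> c3) (word_pairing a1 b1 * word_pairing (a2 \<diamondop> b2) c))))"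
      by (simp add: word_square_def pair_split_sum_append hom pair_append_assoc)
    also have "\<dots> = pair_split_sum a (\<lambda>a2 a3. pair_split_sum b (\<lambda>b2 b3. pair_split_sum r (\<lambda>c c3.
        pair_split_sum c (\<lambda>c1 c2. ?S a1 a2 a3 b1 b2 b3 c1 c2 c3))))"
      by (intro pair_split_sum_cong[OF a] pair_split_sum_cong[OF b] pair_split_sum_cong[OF r] single)
    finally show ?thesis by (simp only: pair_split_sum_coassoc)
  qed
  have right: "scale_comb (word_pairing b1 c1) (word_square p (b \<diamondop> c)) =
      ?three p (\<lambda>a1 a2 a3. pair_split_sum b (\<lambda>b2 b3. pair_split_sum c (\<lambda>c2 c3.
        ?S a1 a2 a3 b2 b1 b3 c2 c1 c3)))"
    if b: "b \<in> W" and c: "c \<in> W" for b1 c1 b c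
  proof -
    have single: "Poly_Mapping.single x (l * word_pairing a (b2 \<diamondop> c2)) =
        pair_split_sum a (\<lambda>a1 a2. Poly_Mapping.single x (word_pairing a1 b2 * (word_pairing a2 c2 * l)))"
      if "a \<in> W" "b2 \<in> W" "c2 \<in> W" for x l a b2 c2
      unfolding word_pairing_append_right[OF that]
      by (subst pair_split_sum_hom[where \<phi> = "\<lambda>y. Poly_Mapping.single x (l * y)"])
        (simp_all add: distrib_left single_add mult_ac)
    have "scale_comb (word_pairing b1 c1) (word_square p (b \<diamondop> c)) =
        pair_split_sum p (\<lambda>a a3. pair_split_sum b (\<lambda>b2 b3. pair_split_sum c (\<lambda>c2 c3.
          Poly_Mapping.single (a3 \<diamondop> b3 \<diamondop> c3) (word_pairing b1 c1 * word_pairing a (b2 \<diamondop> c2)))))"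
      by (simp add: word_square_def pair_split_sum_append hom)
    also have "\<dots> = pair_split_sum p (\<lambda>a a3. pair_split_sum b (\<lambda>b2 b3. pair_split_sum c (\<lambda>c2 c3.
        pair_split_sum a (\<lambda>a1 a2. ?S a1 a2 a3 b2 b1 b3 c2 c1 c3))))"
      by (intro pair_split_sum_cong[OF p] pair_split_sum_cong[OF b] pair_split_sum_cong[OF c] single)
    also have "\<dots> = pair_split_sum p (\<lambda>a a3. pair_split_sum a (\<lambda>a1 a2.
        pair_split_sum b (\<lambda>b2 b3. pair_split_sum c (\<lambda>c2 c3. ?S a1 a2 a3 b2 b1 b3 c2 c1 c3))))"
      by (simp only: pair_split_sum_swap3[of b c])
    finally show ?thesis by (simp only: pair_split_sum_coassoc)
  qed
  have "?lhs = pair_split_sum p (\<lambda>a1 a. pair_split_sum q (\<lambda>b1 b.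
      pair_split_sum a (\<lambda>a2 a3. pair_split_sum b (\<lambda>b2 b3.
        ?three r (\<lambda>c1 c2 c3. ?S a1 a2 a3 b1 b2 b3 c1 c2 c3)))))"
    by (intro pair_split_sum_cong[OF p] pair_split_sum_cong[OF q] left)
  also have "\<dots> = ?three p (\<lambda>a1 a2 a3. ?three q (\<lambda>b1 b2 b3. ?three r (\<lambda>c1 c2 c3.
      ?S a1 a2 a3 b1 b2 b3 c1 c2 c3)))"
    by (simp only: pair_split_sum_swap[of q])
  \<comment> \<open>Cocommutativity: the first two parts of \<open>q\<close> and of \<open>r\<close> are exchanged.\<close>
  also have "\<dots> = ?three p (\<lambda>a1 a2 a3. ?three q (\<lambda>b1 b2 b3. ?three r (\<lambda>c1 c2 c3.
      ?S a1 a2 a3 b2 b1 b3 c2 c1 c3)))"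
    by (subst pair_split_sum_cocomm3[of q], subst pair_split_sum_cocomm3[of r]) (rule refl)
  also have "\<dots> = pair_split_sum q (\<lambda>b1 b. ?three p (\<lambda>a1 a2 a3. pair_split_sum b (\<lambda>b2 b3.
      ?three r (\<lambda>c1 c2 c3. ?S a1 a2 a3 b2 b1 b3 c2 c1 c3))))"
    by (simp only: pair_split_sum_swap[of q])
  also have "\<dots> = pair_split_sum q (\<lambda>b1 b. pair_split_sum r (\<lambda>c1 c.
      ?three p (\<lambda>a1 a2 a3. pair_split_sum b (\<lambda>b2 b3. pair_split_sum c (\<lambda>c2 c3.
        ?S a1 a2 a3 b2 b1 b3 c2 c1 c3)))))"
    by (simp only: pair_split_sum_swap[of r])
  also have "\<dots> = ?rhs"
    by (intro pair_split_sum_cong[OF q] pair_split_sum_cong[OF r] right[symmetric])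
  finally show ?thesis .
qed

lemma square_assoc_words:
  assumes p: "p \<in> W" and q: "q \<in> W" and r: "r \<in> W"
  shows "(joint_word p \<box> joint_word q) \<box> joint_word r = joint_word p \<box> (joint_word q \<box> joint_word r)"
proof -
  note closed = joint_word_closed[OF p] joint_word_closed[OF r]
  have "joint_comb (word_square p q) \<box> joint_word r = joint_comb
      (pair_split_sum p (\<lambda>a1 a2. pair_split_sum q (\<lambda>b1 b2.
        scale_comb (word_pairing a1 b1) (word_square (a2 \<diamondop> b2) r))))"
    by (rule lin_map_joint_comb_word_square[where h = "\<lambda>w. word_square w r",
          OF bilin_mapD(2)[OF square_bilin closed(2)] p q square_words[OF _ r]
          keys_word_square[OF _ r]])
  moreover have "joint_word p \<box> joint_comb (word_square q r) = joint_comb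
      (pair_split_sum q (\<lambda>b1 b2. pair_split_sum r (\<lambda>c1 c2.
        scale_comb (word_pairing b1 c1) (word_square p (b2 \<diamondop> c2)))))"
    by (rule lin_map_joint_comb_word_square[where h = "\<lambda>w. word_square p w",
          OF bilin_mapD(1)[OF square_bilin closed(1)] q r square_words[OF p] keys_word_square[OF p]])
  ultimately show ?thesis
    by (simp only: square_words p q r word_square_assoc)
qed

text \<open>Both sides are linear in each argument; the three arguments are released from words to
  arbitrary elements one after the other, starting with the last.\<close>

lemma square_assoc:
  assumes x: "x \<in> carrier J" and y: "y \<in> carrier J" and z: "z \<in> carrier J"
  shows "(x \<box> y) \<box> z = x \<box> (y \<box> z)"
proof -
  note l = bilin_mapD(1)[OF square_bilin] and r = bilin_mapD(2)[OF square_bilin]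
    and c = bilin_mapD(3)[OF square_bilin] and w = joint_word_closed
    and eq = lin_map_eq_on_joint_words[OF _ _ J.algebra_module]
  have 1: "(joint_word p \<box> joint_word q) \<box> z = joint_word p \<box> (joint_word q \<box> z)"
    if "p \<in> W" "q \<in> W" for p q
    by (rule eq[OF l[OF c[OF w[OF that(1)] w[OF that(2)]]]
          lin_map_comp[OF l[OF w[OF that(2)]] l[OF w[OF that(1)]]] square_assoc_words[OF that] z])
  have 2: "(joint_word p \<box> y) \<box> z = joint_word p \<box> (y \<box> z)" if "p \<in> W" for p
    by (rule eq[OF lin_map_comp[OF l[OF w[OF that]] r[OF z]]
          lin_map_comp[OF r[OF z] l[OF w[OF that]]] 1[OF that] y])
  show ?thesis
    by (rule eq[OF lin_map_comp[OF r[OF y] r[OF z]] r[OF c[OF y z]] 2 x])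
qed

lemma word_square_unit:
  assumes w: "w \<in> W"
  shows "word_square ([], []) w = Poly_Mapping.single w 1"
    and "word_square w ([], []) = Poly_Mapping.single w 1"
proof -
  let ?f = "\<lambda>a b. if a = ([], []) then Poly_Mapping.single b 1 else (0 :: 'u list \<times> 'v list \<Rightarrow>\<^sub>0 'k)"
  have "pair_split_sum w (\<lambda>a b. Poly_Mapping.single b (word_pairing ([], []) a)) =
      pair_split_sum w ?f"
    by (rule pair_split_sum_cong[OF w]) (simp add: word_pairing_unit del: in_lists_conv_set)
  moreover have "pair_split_sum w (\<lambda>a b. Poly_Mapping.single b (word_pairing a ([], []))) =
      pair_split_sum w ?f"
    by (rule pair_split_sum_cong[OF w])
      (simp add: word_pairing_unit word_pairing_sym[of _ "([], [])"] del: in_lists_conv_set)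
  moreover have "pair_split_sum w ?f = Poly_Mapping.single w 1"
    by (subst pair_split_sum_counit) simp_all
  ultimately show "word_square ([], []) w = Poly_Mapping.single w 1"
    "word_square w ([], []) = Poly_Mapping.single w 1"
    by (simp_all add: word_square_def pair_split_sum_def[of "([], [])"])
qed

lemma square_unit:
  assumes x: "x \<in> carrier J"
  shows "\<one>\<^bsub>J\<^esub> \<box> x = x" and "x \<box> \<one>\<^bsub>J\<^esub> = x"
proof -
  have unit: "([], []) \<in> W" by simp
  have id: "lin_map J J (\<lambda>x. x)" by (rule lin_mapI) simp_all
  show "\<one>\<^bsub>J\<^esub> \<box> x = x"
    by (rule lin_map_eq_on_joint_words[OF bilin_mapD(1)[OF square_bilin J.algebra_one_closed] id
          J.algebra_module _ x])
      (simp only: joint_one square_words[OF unit] word_square_unit joint_comb_word)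
  show "x \<box> \<one>\<^bsub>J\<^esub> = x"
    by (rule lin_map_eq_on_joint_words[OF bilin_mapD(2)[OF square_bilin J.algebra_one_closed] id
          J.algebra_module _ x])
      (simp only: joint_one square_words[OF _ unit] word_square_unit joint_comb_word)
qed

lemma square_algebra:
  "unital_associative_algebra ground_field (J\<lparr>mult := square_product U V L\<rparr>)"
proof -
  let ?A = "J\<lparr>mult := square_product U V L\<rparr>"
  note sl = bilin_mapD(1)[OF square_bilin] and sr = bilin_mapD(2)[OF square_bilin]
  have grp: "abelian_group ?A"
    using J.abelian_group_axioms
    by (simp add: abelian_group_def abelian_monoid_def abelian_group_axioms_def)
  have mod: "module ground_field ?A"
    using J.algebra_module grp by (simp add: module_def module_axioms_def)
  have mon: "Group.monoid ?A"
    by (rule Group.monoid.intro)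
      (simp_all add: bilin_mapD(3)[OF square_bilin] J.algebra_one_closed square_assoc square_unit)
  have ring: "ring ?A"
    using lin_mapD(2)[OF sl] lin_mapD(2)[OF sr]
    by (intro ring.intro grp mon ring_axioms.intro) simp_all
  show ?thesis
    using lin_mapD(3)[OF sl] lin_mapD(3)[OF sr]
    by (intro unital_associative_algebra.intro mod ring unital_associative_algebra_axioms.intro)
      simp_all
qed

end

theorem theorem3p6:
  fixes U :: "('k::real_normed_field, 'u) module"
    and V :: "('k, 'v) module"
    and d :: "'u \<Rightarrow> 'v \<Rightarrow> 'k"
    and L :: "('k, 'u, 'v) joint \<Rightarrow> ('k, 'u, 'v) joint \<Rightarrow> 'k"
  assumes "module ground_field U" and "module ground_field V"
    and "bilinear_form U V d"
    and "laplace_pairing U V L" and "compatible_with_duality U V d L"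
  shows "unital_associative_algebra ground_field
           ((joint_algebra U V)\<lparr>mult := square_product U V L\<rparr>)"
proof -
  interpret laplace U V d L
    using assms by (intro laplace.intro ground_pair.intro ground_module.intro laplace_axioms.intro)
  show ?thesis by (rule square_algebra)
qed

end
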